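(* Let a lattice Boltzmann scheme with $N\ge 1$ conserved moments be given, and consider the corresponding macroscopic Finite Difference (FD) schemes $(\mathrm{FD}_i)$, $i=1,\dots,N$, defined in the context. Assume that $M$ and $S$ are fixed (independent of $\Delta x$) as $\Delta x\to 0$ and that the following (diffusive scaling) hold: 1. $\lambda=\Delta x/\Delta t=\mu/\Delta x$, where $\mu>0$ is a fixed real number as $\Delta x\to0$; 2. $\mathcal G_{ij}=0$ for all $i,j\in\{1,\dots,N\}$; 3. $m_i^{\mathrm{eq}}=\Delta x\,\hat m_i^{\mathrm{eq}}$ with $\hat m_i^{\mathrm{eq}}$ fixed as $\Delta x\to0$, for every $i\in\Omega:=\{j\in\{1,\dots,q\}:\ \mathcal G_{\ell j}\neq0\text{ for some }\ell\in\{1,\dots,N\}\}$; 4. $m_i^{\mathrm{eq}}$ is fixed as $\Delta x\to0$, for every $i\notin\Omega$. Then, in the limit $\Delta x\to0$, the FD schemes are consistent with the target PDEs $$\partial_t\tilde m_i+\mu\sum_{\substack{j=N+1\\ j\in\Omega}}^{q}\mathcal G_{ij}\hat m_j^{\mathrm{eq}}(\tilde m_1,\dots,\tilde m_N)-\mu\sum_{j=N+1}^{q}\Big(\frac1{s_j}-\frac12\Big)\mathcal G_{ij}\Big(\sum_{\ell=1}^{N}\mathcal G_{j\ell}\tilde m_\ell+\sum_{\substack{\ell=N+1\\ \ell\notin\Omega}}^{q}\mathcal G_{j\ell}m_\ell^{\mathrm{eq}}(\tilde m_1,\dots,\tilde m_N)\Big)=0,$$ for $i\in\{1,\dots,N\}$.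 For smooth solutions $\tilde m_1,\dots,\tilde m_N:\mathbb R^+\times\mathbb R^d\to\mathbb R$ of these target PDEs, the truncation error is $\tau_i=O(\Delta x)$.
   Context: **Scheme.** Let $d\in\{1,2,3\}$, $\Delta x,\Delta t>0$, $\lambda:=\Delta x/\Delta t$, $q\ge 2$, $c_1,\dots,c_q\in\mathbb Z^d$ (normalized discrete velocities), $N\in\{1,\dots,q-1\}$ (number of conserved moments), $M\in \mathrm{GL}_q(\mathbb R)$ (moment matrix), and $S=\mathrm{diag}(s_1,\dots,s_q)$ (relaxation matrix) with $s_i\in\mathbb R$ for $i\le N$ and $s_i\in(0,2]$ for $i\ge N+1$. The equilibria are a (possibly nonlinear, smooth) function $m^{\mathrm{eq}}:\mathbb R^N\to\mathbb R^q$ of the conserved moments, with $m_i^{\mathrm{eq}}(m_1,\dots,m_N)=m_i$ for $i\le N$. For $z\in\mathbb Z^d$ the space shift is $(\mathsf t_z f)(x)=f(x-z\Delta x)$. FD operators are finite real linear combinations of space shifts; with composition they form a commutative ring $\mathsf D$. The time shift is $(\mathsf z f)(t)=f(t+\Delta t)$; it commutes with $\mathsf D$, and polynomials in $\mathsf z$ with coefficients in $\mathsf D$ form a commutative ring. Put $\mathsf T:=M\,\mathrm{diag}(\mathsf t_{c_1},\dots,\mathsf t_{c_q})M^{-1}$, $\mathsf A:=\mathsf T(I-S)$, $\mathsf B:=\mathsf TS$. The lattice Boltzmann scheme is $\mathsf z\, m=\mathsf A m+\mathsf B m^{\mathrm{eq}}(m_1,\dots,m_N)$ for the vector of moments $m=(m_1,\dots,m_q)^{\intercal}$.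 **Corresponding FD schemes.** For $i\in\{1,\dots,N\}$ let $\mathsf A_i$ be the matrix obtained from $\mathsf A$ by keeping the entries whose row and column indices both lie in $\{i\}\cup\{N+1,\dots,q\}$ and setting all the others to zero, and $\mathsf A_i^\diamond:=\mathsf A-\mathsf A_i$. The $i$-th corresponding FD scheme, which involves only the conserved moments (the coefficients of the non-conserved moments in $(\mathrm{adj}(\mathsf zI-\mathsf A_i)\mathsf A_i^\diamond m)_i$ vanish), is $$(\mathrm{FD}_i)\qquad \det(\mathsf zI-\mathsf A_i)\,m_i=\big(\mathrm{adj}(\mathsf zI-\mathsf A_i)\,\mathsf A_i^\diamond\, m\big)_i+\big(\mathrm{adj}(\mathsf zI-\mathsf A_i)\,\mathsf B\, m^{\mathrm{eq}}\big)_i ,$$ where $\mathrm{adj}$ is the adjugate (transpose of the cofactor matrix). An overall time shift of the scheme (e.g. by $\mathsf z^{-(q-1)}$, so that the latest time is $t+\Delta t$) gives the same scheme. **Momentum-velocity operator matrix.** $\mathcal G:=M\Big(\sum_{|\nu|=1}\mathrm{diag}(c_1^{\nu},\dots,c_q^{\nu})\,\partial^{\nu}\Big)M^{-1}$ ($\nu\in\mathbb N^d$ multi-index, $\partial^\nu$ in the space variables), a $q\times q$ matrix of first-order differential operators in space with entries $\mathcal G_{ij}$. Operators $\mathcal G_{ij}$ act on everything to their right. **Truncation error and consistency.** Let $R_i(m_1,\dots,m_N)$ be the left-hand side minus the right-hand side of $(\mathrm{FD}_i)$, applied to smooth functions of $(t,x)\in\mathbb R^+\times\mathbb R^d$. With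 $\Pi:=\prod_{j=N+1}^q s_j\ne0$, the truncation error on a smooth solution of the target PDEs (not depending on $\Delta x$) is $\tau_i:=-R_i(\tilde m_1,\dots,\tilde m_N)/(\Pi\Delta t)$; the scheme is consistent with the target PDEs if $\tau_i\to0$ as $\Delta x\to0$ for smooth solutions $\tilde m_1,\dots,\tilde m_N$. $O(\cdot)$ is understood as $\Delta x\to0$. *)

theory Defs
  imports
    "HOL-Analysis.Analysis"
    "HOL-Library.Landau_Symbols"
    "HOL-Library.Poly_Mapping"
    "HOL-Computational_Algebra.Polynomial"
begin

text \<open>
  The dimensions are carried by finite index types: \<open>d = CARD('d)\<close>, and the \<open>q\<close> moments
  (as well as the \<open>q\<close> velocities) are indexed by \<open>'n + 'k\<close>, where \<open>Inl i\<close> are the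
  \<open>N = CARD('n)\<close> conserved moments and \<open>Inr j\<close> the \<open>q - N = CARD('k)\<close> non-conserved ones.
  Index types are nonempty, hence \<open>q \<ge> 2\<close> and \<open>1 \<le> N \<le> q - 1\<close>.
\<close>


section \<open>Smooth functions\<close>

text \<open>\<open>k\<close> times continuously differentiable on an open set.\<close>

primrec Ck_on ::
  "nat \<Rightarrow> ('a::real_normed_vector \<Rightarrow> 'b::real_normed_vector) \<Rightarrow> 'a set \<Rightarrow> bool" where
  "Ck_on 0 f U \<longleftrightarrow> continuous_on U f"
| "Ck_on (Suc k) f U \<longleftrightarrow>
     (\<forall>x\<in>U. f differentiable (at x)) \<and>
     (\<forall>v. Ck_on k (\<lambda>x. frechet_derivative f (at x) v) U)"

definition smooth_on ::
  "('a::real_normed_vector \<Rightarrow> 'b::real_normed_vector) \<Rightarrow> 'a set \<Rightarrow> bool" where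
  "smooth_on f U \<longleftrightarrow> (\<forall>k. Ck_on k f U)"


section \<open>Finite difference operators\<close>

text \<open>
  The ring of FD operators is the group ring of the lattice: \<open>Poly_Mapping.single z a\<close>
  stands for \<open>a\<close> times the shift by \<open>z\<close>.  Its product is convolution, which corresponds to
  composition of operators (lemma \<open>fd_apply_mult\<close> below).  The space step enters only
  when an operator acts on a function.
\<close>

type_synonym 'd fd_op = "(int ^ 'd) \<Rightarrow>\<^sub>0 real"

definition space_shift :: "int ^ 'd::finite \<Rightarrow> 'd fd_op" where
  "space_shift z = Poly_Mapping.single z 1"

definition fd_const :: "real \<Rightarrow> 'd::finite fd_op" where
  "fd_const a = Poly_Mapping.single 0 a"

definition lattice_vec :: "int ^ 'd::finite \<Rightarrow> real ^ 'd" where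
  "lattice_vec z = (\<chi> k. of_int (z $ k))"

definition fd_apply ::
  "real \<Rightarrow> 'd::finite fd_op \<Rightarrow> (real ^ 'd \<Rightarrow> real) \<Rightarrow> real ^ 'd \<Rightarrow> real" where
  "fd_apply dx D f x =
     (\<Sum>z\<in>Poly_Mapping.keys D. Poly_Mapping.lookup D z * f (x - dx *\<^sub>R lattice_vec z))"

text \<open>
  The polynomial variable is the time shift \<open>(t, x) \<mapsto> (t + dt, x)\<close>.
\<close>

definition st_apply ::
  "real \<Rightarrow> real \<Rightarrow> 'd::finite fd_op poly \<Rightarrow> (real \<times> (real ^ 'd) \<Rightarrow> real) \<Rightarrow> real \<times> (real ^ 'd) \<Rightarrow> real"
  where
  "st_apply dx dt P f = (\<lambda>(t, x).
     (\<Sum>k\<le>degree P. fd_apply dx (coeff P k) (\<lambda>y. f (t + real k * dt, y)) x))"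


section \<open>Matrices\<close>

definition diag_matrix :: "('q \<Rightarrow> 'a::zero) \<Rightarrow> 'a ^ 'q::finite ^ 'q" where
  "diag_matrix v = (\<chi> i j. if i = j then v i else 0)"

text \<open>
  A finite index type has no distinguished order, so the signed minor at \<open>(i, j)\<close> is taken
  as the determinant of the matrix whose row \<open>i\<close> and column \<open>j\<close> are replaced by unit vectors
  with the 1 in position \<open>(i, j)\<close>.
\<close>

definition cofactor_matrix :: "'a::comm_ring_1 ^ 'q::finite ^ 'q \<Rightarrow> 'a ^ 'q ^ 'q" where
  "cofactor_matrix X = (\<chi> i j. det (\<chi> k l.
     if k = i \<and> l = j then 1 else if k = i \<or> l = j then 0 else X $ k $ l))"

definition adjugate :: "'a::comm_ring_1 ^ 'q::finite ^ 'q \<Rightarrow> 'a ^ 'q ^ 'q" where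
  "adjugate X = transpose (cofactor_matrix X)"


section \<open>The scheme and its corresponding FD schemes\<close>

text \<open>
  Throughout, \<open>c\<close> are the normalized discrete velocities, \<open>M\<close> is the moment matrix and \<open>s\<close>
  the diagonal of the relaxation matrix.
\<close>

definition lbm_T ::
  "('q \<Rightarrow> int ^ 'd) \<Rightarrow> real ^ 'q ^ 'q \<Rightarrow> ('d::finite fd_op) ^ 'q::finite ^ 'q" where
  "lbm_T c M = map_matrix fd_const M ** diag_matrix (\<lambda>l. space_shift (c l))
                 ** map_matrix fd_const (matrix_inv M)"

definition lbm_A ::
  "('q \<Rightarrow> int ^ 'd) \<Rightarrow> real ^ 'q ^ 'q \<Rightarrow> real ^ 'q \<Rightarrow> ('d::finite fd_op) ^ 'q::finite ^ 'q" where
  "lbm_A c M s = lbm_T c M ** map_matrix fd_const (mat 1 - diag_matrix (($) s))"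

definition lbm_B ::
  "('q \<Rightarrow> int ^ 'd) \<Rightarrow> real ^ 'q ^ 'q \<Rightarrow> real ^ 'q \<Rightarrow> ('d::finite fd_op) ^ 'q::finite ^ 'q" where
  "lbm_B c M s = lbm_T c M ** map_matrix fd_const (diag_matrix (($) s))"

definition keep_block ::
  "'n \<Rightarrow> 'a::zero ^ ('n::finite + 'k::finite) ^ ('n + 'k) \<Rightarrow> 'a ^ ('n + 'k) ^ ('n + 'k)" where
  "keep_block i X = (\<chi> k l.
     if k \<in> insert (Inl i) (range Inr) \<and> l \<in> insert (Inl i) (range Inr) then X $ k $ l else 0)"

definition lbm_A_diamond ::
  "(('n::finite + 'k::finite) \<Rightarrow> int ^ 'd) \<Rightarrow> real ^ ('n + 'k) ^ ('n + 'k) \<Rightarrow> real ^ ('n + 'k)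
     \<Rightarrow> 'n \<Rightarrow> ('d::finite fd_op) ^ ('n + 'k) ^ ('n + 'k)" where
  "lbm_A_diamond c M s i = lbm_A c M s - keep_block i (lbm_A c M s)"

definition fd_char_matrix ::
  "(('n::finite + 'k::finite) \<Rightarrow> int ^ 'd) \<Rightarrow> real ^ ('n + 'k) ^ ('n + 'k) \<Rightarrow> real ^ ('n + 'k)
     \<Rightarrow> 'n \<Rightarrow> ('d::finite fd_op poly) ^ ('n + 'k) ^ ('n + 'k)" where
  "fd_char_matrix c M s i =
     mat [:0, 1:] - map_matrix (\<lambda>a. [:a:]) (keep_block i (lbm_A c M s))"

text \<open>
  Left-hand side minus right-hand side of the \<open>i\<close>-th FD scheme.  In the contribution of the
  moment vector only the conserved moments are summed over; the other coefficients
  vanish by lemma \<open>nonconserved_coefficient_zero\<close> below.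
\<close>

definition fd_residual ::
  "(('n::finite + 'k::finite) \<Rightarrow> int ^ 'd) \<Rightarrow> real ^ ('n + 'k) ^ ('n + 'k) \<Rightarrow> real ^ ('n + 'k)
     \<Rightarrow> (real ^ 'n \<Rightarrow> real ^ ('n + 'k)) \<Rightarrow> real \<Rightarrow> real \<Rightarrow> 'n
     \<Rightarrow> (real \<times> (real ^ 'd::finite) \<Rightarrow> real ^ 'n) \<Rightarrow> real \<times> (real ^ 'd) \<Rightarrow> real" where
  "fd_residual c M s meq dx dt i u p =
     (let Z = fd_char_matrix c M s i;
          P = adjugate Z ** map_matrix (\<lambda>a. [:a:]) (lbm_A_diamond c M s i);
          Q = adjugate Z ** map_matrix (\<lambda>a. [:a:]) (lbm_B c M s)
      in st_apply dx dt (det Z) (\<lambda>p'. u p' $ i) p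
         - ((\<Sum>j\<in>UNIV. st_apply dx dt (P $ Inl i $ Inl j) (\<lambda>p'. u p' $ j) p)
            + (\<Sum>j\<in>UNIV. st_apply dx dt (Q $ Inl i $ j) (\<lambda>p'. meq (u p') $ j) p)))"

definition truncation_error ::
  "(('n::finite + 'k::finite) \<Rightarrow> int ^ 'd) \<Rightarrow> real ^ ('n + 'k) ^ ('n + 'k) \<Rightarrow> real ^ ('n + 'k)
     \<Rightarrow> (real ^ 'n \<Rightarrow> real ^ ('n + 'k)) \<Rightarrow> real \<Rightarrow> real \<Rightarrow> 'n
     \<Rightarrow> (real \<times> (real ^ 'd::finite) \<Rightarrow> real ^ 'n) \<Rightarrow> real \<times> (real ^ 'd) \<Rightarrow> real" where
  "truncation_error c M s meq dx dt i u p =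
     - fd_residual c M s meq dx dt i u p / ((\<Prod>j\<in>UNIV. s $ Inr j) * dt)"


section \<open>The momentum-velocity operator matrix and the target equations\<close>

definition space_partial :: "'d \<Rightarrow> (real ^ 'd::finite \<Rightarrow> real) \<Rightarrow> real ^ 'd \<Rightarrow> real" where
  "space_partial k f x = deriv (\<lambda>h. f (x + h *\<^sub>R axis k 1)) 0"

definition time_partial :: "(real \<times> 'a \<Rightarrow> real) \<Rightarrow> real \<times> 'a \<Rightarrow> real" where
  "time_partial f = (\<lambda>(t, x). deriv (\<lambda>r. f (r, x)) t)"

text \<open>
  Multi-indices of length one are the unit vectors, so a homogeneous first-order operator with
  constant coefficients is given by one coefficient per space direction: the entry \<open>(i, j)\<close> of
  the operator matrix is \<open>\<Sum>k. (mv_coeff c M i j $ k) \<partial>\<^sub>k\<close>.  In particular it is the zero operator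
  iff \<open>mv_coeff c M i j = 0\<close> (lemma \<open>mv_op_eq_0_iff\<close> below).
\<close>

definition mv_coeff ::
  "('q \<Rightarrow> int ^ 'd::finite) \<Rightarrow> real ^ 'q::finite ^ 'q \<Rightarrow> 'q \<Rightarrow> 'q \<Rightarrow> real ^ 'd" where
  "mv_coeff c M i j =
     (\<chi> k. (M ** diag_matrix (\<lambda>l. of_int (c l $ k)) ** matrix_inv M) $ i $ j)"

definition mv_op ::
  "('q \<Rightarrow> int ^ 'd::finite) \<Rightarrow> real ^ 'q::finite ^ 'q \<Rightarrow> 'q \<Rightarrow> 'q
     \<Rightarrow> (real ^ 'd \<Rightarrow> real) \<Rightarrow> real ^ 'd \<Rightarrow> real" where
  "mv_op c M i j f x = (\<Sum>k\<in>UNIV. mv_coeff c M i j $ k * space_partial k f x)"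

definition Omega ::
  "(('n::finite + 'k::finite) \<Rightarrow> int ^ 'd::finite) \<Rightarrow> real ^ ('n + 'k) ^ ('n + 'k) \<Rightarrow> ('n + 'k) set"
  where
  "Omega c M = {j. \<exists>l. mv_coeff c M (Inl l) j \<noteq> 0}"

definition target_lhs ::
  "(('n::finite + 'k::finite) \<Rightarrow> int ^ 'd::finite) \<Rightarrow> real ^ ('n + 'k) ^ ('n + 'k)
     \<Rightarrow> real ^ ('n + 'k) \<Rightarrow> real \<Rightarrow> ('n + 'k \<Rightarrow> real ^ 'n \<Rightarrow> real) \<Rightarrow> ('n + 'k \<Rightarrow> real ^ 'n \<Rightarrow> real)
     \<Rightarrow> 'n \<Rightarrow> (real \<times> (real ^ 'd) \<Rightarrow> real ^ 'n) \<Rightarrow> real \<times> (real ^ 'd) \<Rightarrow> real" where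
  "target_lhs c M s \<mu> mhat mfix i u = (\<lambda>(t, x).
     time_partial (\<lambda>p. u p $ i) (t, x)
     + \<mu> * (\<Sum>j | Inr j \<in> Omega c M.
         mv_op c M (Inl i) (Inr j) (\<lambda>y. mhat (Inr j) (u (t, y))) x)
     - \<mu> * (\<Sum>j\<in>UNIV. (1 / s $ Inr j - 1 / 2) *
         mv_op c M (Inl i) (Inr j)
           (\<lambda>y. (\<Sum>l\<in>UNIV. mv_op c M (Inr j) (Inl l) (\<lambda>w. u (t, w) $ l) y)
              + (\<Sum>l | Inr l \<notin> Omega c M.
                   mv_op c M (Inr j) (Inr l) (\<lambda>w. mfix (Inr l) (u (t, w))) y)) x))"

definition smooth_target_solution ::
  "(('n::finite + 'k::finite) \<Rightarrow> int ^ 'd::finite) \<Rightarrow> real ^ ('n + 'k) ^ ('n + 'k)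
     \<Rightarrow> real ^ ('n + 'k) \<Rightarrow> real \<Rightarrow> ('n + 'k \<Rightarrow> real ^ 'n \<Rightarrow> real) \<Rightarrow> ('n + 'k \<Rightarrow> real ^ 'n \<Rightarrow> real)
     \<Rightarrow> (real \<times> (real ^ 'd) \<Rightarrow> real ^ 'n) \<Rightarrow> bool" where
  "smooth_target_solution c M s \<mu> mhat mfix u \<longleftrightarrow>
     smooth_on u ({0<..} \<times> UNIV) \<and>
     (\<forall>i. \<forall>t>0. \<forall>x. target_lhs c M s \<mu> mhat mfix i u (t, x) = 0)"

text \<open>
  Here the equilibria \<open>meq\<close> and the time step \<open>dt\<close> are functions of the space step, and \<open>Sol\<close>
  is the set of smooth solutions of the target equations.
\<close>

definition consistent_with ::
  "(('n::finite + 'k::finite) \<Rightarrow> int ^ 'd::finite) \<Rightarrow> real ^ ('n + 'k) ^ ('n + 'k)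
     \<Rightarrow> real ^ ('n + 'k) \<Rightarrow> (real \<Rightarrow> real ^ 'n \<Rightarrow> real ^ ('n + 'k)) \<Rightarrow> (real \<Rightarrow> real)
     \<Rightarrow> (real \<times> (real ^ 'd) \<Rightarrow> real ^ 'n) set \<Rightarrow> bool" where
  "consistent_with c M s meq dt Sol \<longleftrightarrow>
     (\<forall>u\<in>Sol. \<forall>i. \<forall>t>0. \<forall>x.
        ((\<lambda>dx. truncation_error c M s (meq dx) dx (dt dx) i u (t, x)) \<longlongrightarrow> 0) (at_right 0))"


section \<open>Justification of the encodings\<close>

lemma fd_apply_eq_sum:
  assumes "finite A" "Poly_Mapping.keys D \<subseteq> A"
  shows "fd_apply dx D f x =
    (\<Sum>z\<in>A. Poly_Mapping.lookup D z * f (x - dx *\<^sub>R lattice_vec z))"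
  unfolding fd_apply_def using assms
  by (intro sum.mono_neutral_left) (auto simp: in_keys_iff)

lemma fd_apply_add: "fd_apply dx (D + E) f x = fd_apply dx D f x + fd_apply dx E f x"
proof -
  let ?A = "Poly_Mapping.keys D \<union> Poly_Mapping.keys E"
  have "fd_apply dx G f x = (\<Sum>z\<in>?A. Poly_Mapping.lookup G z * f (x - dx *\<^sub>R lattice_vec z))"
    if "G \<in> {D, E, D + E}" for G
    using that Poly_Mapping.keys_add[of D E] by (intro fd_apply_eq_sum) auto
  then show ?thesis
    by (simp add: lookup_add distrib_right sum.distrib)
qed

lemma fd_apply_0 [simp]: "fd_apply dx 0 f x = 0"
  by (simp add: fd_apply_def)

lemma fd_apply_single:
  "fd_apply dx (Poly_Mapping.single z a) f x = a * f (x - dx *\<^sub>R lattice_vec z)"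
  by (simp add: fd_apply_def)

lemma fd_apply_add_fun:
  "fd_apply dx D (\<lambda>y. f y + g y) x = fd_apply dx D f x + fd_apply dx D g x"
  by (simp add: fd_apply_def distrib_left sum.distrib)

lemma lattice_vec_add: "lattice_vec (z + w) = lattice_vec z + lattice_vec w"
  by (simp add: lattice_vec_def vec_eq_iff)

lemma fd_op_induct [case_names zero single_add]:
  fixes D :: "'d::finite fd_op"
  assumes "P 0" and "\<And>z a D. P D \<Longrightarrow> P (Poly_Mapping.single z a + D)"
  shows "P D"
proof -
  have "P (\<Sum>z\<in>A. Poly_Mapping.single z (Poly_Mapping.lookup D z))" if "finite A" for A
    using that assms by induction auto
  moreover have "D = (\<Sum>z\<in>Poly_Mapping.keys D. Poly_Mapping.single z (Poly_Mapping.lookup D z))"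
    by (rule poly_mapping_eqI)
       (auto simp: lookup_sum lookup_single when_def in_keys_iff sum.delta)
  ultimately show ?thesis by (metis finite_keys)
qed

lemma fd_apply_mult: "fd_apply dx (D * E) f x = fd_apply dx D (fd_apply dx E f) x"
proof (induction D arbitrary: x rule: fd_op_induct)
  case zero
  show ?case by simp
next
  case (single_add z a D)
  have "fd_apply dx (Poly_Mapping.single z a * E) f x
          = a * fd_apply dx E f (x - dx *\<^sub>R lattice_vec z)" for E
  proof (induction E rule: fd_op_induct)
    case zero
    show ?case by simp
  next
    case (single_add w b E)
    then show ?case
      by (simp add: distrib_left fd_apply_add fd_apply_single mult_single lattice_vec_add
            scaleR_add_right diff_diff_eq)
  qed
  then show ?case
    using single_add by (simp add: distrib_right fd_apply_add fd_apply_single)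
qed

lemma space_partial_inner: "space_partial k (\<lambda>y. v \<bullet> y) x = v $ k"
proof -
  have "((\<lambda>h. v \<bullet> (x + h *\<^sub>R axis k 1)) has_real_derivative (v $ k)) (at 0)"
    by (auto simp: inner_add_right inner_axis intro!: derivative_eq_intros)
  then show ?thesis
    unfolding space_partial_def by (rule DERIV_imp_deriv)
qed

lemma mv_op_eq_0_iff: "mv_op c M i j = (\<lambda>f x. 0) \<longleftrightarrow> mv_coeff c M i j = 0"
proof
  assume "mv_op c M i j = (\<lambda>f x. 0)"
  then have "mv_op c M i j (\<lambda>y. mv_coeff c M i j \<bullet> y) 0 = 0"
    by metis
  then have "mv_coeff c M i j \<bullet> mv_coeff c M i j = 0"
    unfolding mv_op_def space_partial_inner by (simp add: inner_vec_def)
  then show "mv_coeff c M i j = 0" by simp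
qed (auto simp: mv_op_def fun_eq_iff)

lemma cofactor_matrix_row:
  fixes X :: "'a::comm_ring_1 ^ 'q::finite ^ 'q"
  shows "cofactor_matrix X $ i $ j = det (\<chi> k. if k = i then axis j 1 else X $ k)"
proof -
  have "(\<Prod>k\<in>UNIV. if k = i \<and> p k = j then 1 else if k = i \<or> p k = j then 0 else X $ k $ p k)
          = (\<Prod>k\<in>UNIV. (if k = i then axis j 1 else X $ k) $ p k)"
    if "p permutes UNIV" for p
  proof (cases "p i = j")
    case True
    then have "p k = j \<longleftrightarrow> k = i" for k
      using permutes_inj[OF that] by (metis injD)
    then show ?thesis
      by (intro prod.cong) (auto simp: axis_def)
  next
    case False
    then have "(\<Prod>k\<in>UNIV. if k = i \<and> p k = j then 1
                  else if k = i \<or> p k = j then 0 else X $ k $ p k) = 0"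
      by (intro prod_zero) (auto intro!: exI[of _ i])
    moreover from False have "(\<Prod>k\<in>UNIV. (if k = i then axis j 1 else X $ k) $ p k) = 0"
      by (intro prod_zero) (auto simp: axis_def intro!: exI[of _ i])
    ultimately show ?thesis by simp
  qed
  then show ?thesis
    unfolding cofactor_matrix_def det_def by (auto intro!: sum.cong)
qed

lemma matrix_mult_adjugate:
  fixes X :: "'a::comm_ring_1 ^ 'q::finite ^ 'q"
  shows "X ** adjugate X = mat (det X)"
proof -
  have "(\<Sum>k\<in>UNIV. X $ j $ k * cofactor_matrix X $ i $ k) = (if j = i then det X else 0)" for i j
  proof -
    have "(\<Sum>k\<in>UNIV. X $ j $ k * cofactor_matrix X $ i $ k)
            = (\<Sum>k\<in>UNIV. det (\<chi> l. if l = i then X $ j $ k *s axis k 1 else X $ l))"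
      by (simp add: cofactor_matrix_row det_row_mul)
    also have "\<dots> = det (\<chi> l. if l = i then \<Sum>k\<in>UNIV. X $ j $ k *s axis k 1 else X $ l)"
      by (rule det_linear_row_sum[symmetric]) simp
    also have "(\<Sum>k\<in>UNIV. X $ j $ k *s axis k 1) = X $ j"
      by (simp add: vec_eq_iff axis_def if_distrib cong: if_cong)
    also have "det (\<chi> l. if l = i then X $ j else X $ l) = (if j = i then det X else 0)"
    proof (cases "j = i")
      case True
      then have "(\<chi> l. if l = i then X $ j else X $ l) = X"
        by (simp add: vec_eq_iff)
      with True show ?thesis by simp
    next
      case False
      then show ?thesis
        by (auto simp: row_def vec_eq_iff intro: det_identical_rows[of i j])
    qed
    finally show ?thesis .
  qed
  then show ?thesis
    by (simp add: vec_eq_iff matrix_matrix_mult_def adjugate_def transpose_def mat_def)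
qed

lemma det_eq_0_column:
  fixes X :: "'a::comm_ring_1 ^ 'q::finite ^ 'q"
  assumes "\<And>k. X $ k $ j = 0"
  shows "det X = 0"
proof -
  have "(\<Prod>k\<in>UNIV. X $ k $ p k) = 0" if "p permutes UNIV" for p
  proof (rule prod_zero)
    from permutes_surj[OF that] obtain k where "p k = j" by (metis surjD)
    with assms show "\<exists>k\<in>UNIV. X $ k $ p k = 0" by auto
  qed simp
  then show ?thesis by (simp add: det_def)
qed

lemma nonconserved_coefficient_zero:
  "(adjugate (fd_char_matrix c M s i) ** map_matrix (\<lambda>a. [:a:]) (lbm_A_diamond c M s i))
     $ Inl i $ Inr k = 0"
proof -
  have "cofactor_matrix (fd_char_matrix c M s i) $ Inl j $ Inl i = 0" if "j \<noteq> i" for j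
  proof -
    have "det (\<chi> k l. if k = Inl j \<and> l = Inl i then 1
            else if k = Inl j \<or> l = Inl i then 0 else fd_char_matrix c M s i $ k $ l) = 0"
      using that
      by (intro det_eq_0_column[of _ "Inl j"])
         (auto simp: fd_char_matrix_def keep_block_def mat_def)
    then show ?thesis
      by (simp add: cofactor_matrix_def)
  qed
  moreover have "lbm_A_diamond c M s i $ l $ Inr k = 0" if "l \<notin> {Inl j |j. j \<noteq> i}" for l
    using that by (cases l) (auto simp: lbm_A_diamond_def keep_block_def)
  ultimately have "adjugate (fd_char_matrix c M s i) $ Inl i $ l
      * [:lbm_A_diamond c M s i $ l $ Inr k:] = 0" for l
    by (cases "l \<in> {Inl j |j. j \<noteq> i}") (auto simp: adjugate_def transpose_def)
  then show ?thesis
    by (simp add: matrix_matrix_mult_def)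
qed

end

theory Submission
  imports Defs
begin

text \<open>
  Since \<open>adj(zI - A\<^sub>i) (zI - A\<^sub>i) = det(zI - A\<^sub>i)\<close>, for every choice of the non-conserved
  moments the residual of the \<open>i\<close>-th FD scheme is row \<open>i\<close> of \<open>adj(zI - A\<^sub>i)\<close> applied to
  the defect \<open>z m - A m - B m\<^sup>e\<^sup>q\<close> of the lattice Boltzmann scheme.  It therefore suffices to
  complete the solution \<open>u\<close> of the target equations by non-conserved moments for which all
  components of the defect are \<open>O(dx\<^sup>3)\<close>, locally uniformly in space-time.  Such moments are
  given by a Chapman-Enskog ansatz \<open>a\<^sub>0 + dx a\<^sub>1 + dx\<^sup>2 a\<^sub>2\<close>: as \<open>dt = dx\<^sup>2/\<mu>\<close> and
  \<open>T = exp(- dx G)\<close>, Taylor expansion of the non-conserved rows determines \<open>a\<^sub>0, a\<^sub>1, a\<^sub>2\<close>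
  successively, while the second order of the conserved rows is the target system.
\<close>

section \<open>Smooth functions and directional derivatives\<close>

lemma Ck_on_imp_differentiable: "Ck_on (Suc k) f U \<Longrightarrow> x \<in> U \<Longrightarrow> f differentiable (at x)"
  by simp

lemma smooth_on_imp_differentiable: "smooth_on f U \<Longrightarrow> x \<in> U \<Longrightarrow> f differentiable (at x)"
  unfolding smooth_on_def using Ck_on_imp_differentiable by blast

lemma smooth_on_imp_continuous_on: "smooth_on f U \<Longrightarrow> continuous_on U f"
  unfolding smooth_on_def by (metis Ck_on.simps(1))

text \<open>The recursion only speaks of derivatives along fixed vectors, so lowering the order
  needs induction, starting from differentiability implying continuity. The product and chain rules
  use it for the factors that stay undifferentiated.\<close>

lemma Ck_on_Suc_imp_Ck_on: "Ck_on (Suc k) f U \<Longrightarrow> Ck_on k f U"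
proof (induction k arbitrary: f)
  case 0
  then show ?case
    by (auto intro!: continuous_at_imp_continuous_on differentiable_imp_continuous_within)
next
  case (Suc k)
  from Suc.prems have "Ck_on k (\<lambda>x. frechet_derivative f (at x) v) U" for v
    by (intro Suc.IH) (subst (asm) Ck_on.simps(2), blast)
  with Suc.prems show ?case by simp
qed

text \<open>\<open>frechet_derivative\<close> is a choice among all derivatives at the point.
  Functions agreeing near \<open>x\<close> have the same candidates, hence the same chosen value,
  even where no derivative exists.\<close>

lemma frechet_derivative_cong_open:
  assumes "open U" "x \<in> U" "\<And>y. y \<in> U \<Longrightarrow> f y = g y"
  shows "frechet_derivative f (at x) = frechet_derivative g (at x)"
proof -
  have "(f has_derivative D) (at x) \<longleftrightarrow> (g has_derivative D) (at x)" for D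
    using assms by (metis has_derivative_transform_within_open)
  then show ?thesis by (simp add: frechet_derivative_def)
qed

lemma differentiable_cong_open:
  assumes "open U" "x \<in> U" "\<And>y. y \<in> U \<Longrightarrow> f y = g y" "f differentiable (at x)"
  shows "g differentiable (at x)"
  using assms(4) has_derivative_transform_within_open[of f _ x UNIV U g] assms(1-3)
  unfolding differentiable_def by blast

text \<open>Derivative formulas are available only at points of \<open>U\<close>. This lemma lets
  each closure rule below replace the chosen derivative by its explicit formula there.\<close>

lemma Ck_on_cong:
  assumes "open U" "\<And>y. y \<in> U \<Longrightarrow> f y = g y" "Ck_on k f U"
  shows "Ck_on k g U"
  using assms(2,3)
proof (induction k arbitrary: f g)
  case 0
  then show ?case by (metis Ck_on.simps(1) continuous_on_cong)
next
  case (Suc k)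
  have "Ck_on k (\<lambda>x. frechet_derivative g (at x) v) U" for v
  proof (rule Suc.IH)
    show "Ck_on k (\<lambda>x. frechet_derivative f (at x) v) U"
      using Suc.prems by simp
  qed (use Suc.prems frechet_derivative_cong_open[OF assms(1)] in metis)
  moreover have "g differentiable (at x)" if "x \<in> U" for x
  proof (rule differentiable_cong_open[OF assms(1) that])
    show "f differentiable (at x)" using Suc.prems that by simp
  qed (rule Suc.prems(1))
  ultimately show ?case by simp
qed

lemma Ck_on_const: "Ck_on k (\<lambda>x. a) U"
  by (induction k arbitrary: a) auto

lemma Ck_on_add:
  assumes "open U" "Ck_on k f U" "Ck_on k g U"
  shows "Ck_on k (\<lambda>x. f x + g x) U"
  using assms(2,3)
proof (induction k arbitrary: f g)
  case 0
  then show ?case by (auto intro: continuous_intros)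
next
  case (Suc k)
  have d: "((\<lambda>x. f x + g x) has_derivative
      (\<lambda>v. frechet_derivative f (at x) v + frechet_derivative g (at x) v)) (at x)"
    if "x \<in> U" for x
    using Suc.prems that frechet_derivative_works
    by (intro has_derivative_add) auto
  have "Ck_on k (\<lambda>x. frechet_derivative (\<lambda>x. f x + g x) (at x) v) U" for v
  proof (rule Ck_on_cong[OF assms(1)])
    show "Ck_on k (\<lambda>x. frechet_derivative f (at x) v + frechet_derivative g (at x) v) U"
      using Suc by simp
    show "frechet_derivative f (at x) v + frechet_derivative g (at x) v
        = frechet_derivative (\<lambda>x. f x + g x) (at x) v" if "x \<in> U" for x
      using frechet_derivative_at[OF d[OF that]] by metis
  qed
  with Suc.prems show ?case by (auto intro: differentiable_add)
qed

lemma Ck_on_bounded_linear: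
  assumes "open U" "bounded_linear L" "Ck_on k f U"
  shows "Ck_on k (\<lambda>x. L (f x)) U"
  using assms(3)
proof (induction k arbitrary: f)
  case 0
  with assms(2) show ?case
    by (auto intro: bounded_linear.continuous_on)
next
  case (Suc k)
  have d: "((\<lambda>x. L (f x)) has_derivative (\<lambda>v. L (frechet_derivative f (at x) v))) (at x)"
    if "x \<in> U" for x
    using Suc.prems that frechet_derivative_works
    by (intro bounded_linear.has_derivative[OF assms(2)]) auto
  have "Ck_on k (\<lambda>x. frechet_derivative (\<lambda>x. L (f x)) (at x) v) U" for v
  proof (rule Ck_on_cong[OF assms(1)])
    show "Ck_on k (\<lambda>x. L (frechet_derivative f (at x) v)) U"
      using Suc by simp
    show "L (frechet_derivative f (at x) v) = frechet_derivative (\<lambda>x. L (f x)) (at x) v"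
      if "x \<in> U" for x
      using frechet_derivative_at[OF d[OF that]] by metis
  qed
  with d show ?case by (auto simp: differentiable_def)
qed

lemma Ck_on_mult:
  fixes f g :: "'a::real_normed_vector \<Rightarrow> real"
  assumes "open U" "Ck_on k f U" "Ck_on k g U"
  shows "Ck_on k (\<lambda>x. f x * g x) U"
  using assms(2,3)
proof (induction k arbitrary: f g)
  case 0
  then show ?case by (auto intro: continuous_intros)
next
  case (Suc k)
  have d: "((\<lambda>x. f x * g x) has_derivative
      (\<lambda>v. f x * frechet_derivative g (at x) v + frechet_derivative f (at x) v * g x)) (at x)"
    if "x \<in> U" for x
    using Suc.prems that frechet_derivative_works
    by (intro has_derivative_mult) auto
  have "Ck_on k (\<lambda>x. frechet_derivative (\<lambda>x. f x * g x) (at x) v) U" for v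
  proof (rule Ck_on_cong[OF assms(1)])
    show "Ck_on k (\<lambda>x. f x * frechet_derivative g (at x) v + frechet_derivative f (at x) v * g x) U"
      using Suc.prems Ck_on_Suc_imp_Ck_on[OF Suc.prems(1)] Ck_on_Suc_imp_Ck_on[OF Suc.prems(2)]
      by (intro Ck_on_add[OF assms(1)] Suc.IH) simp_all
    show "f x * frechet_derivative g (at x) v + frechet_derivative f (at x) v * g x
        = frechet_derivative (\<lambda>x. f x * g x) (at x) v" if "x \<in> U" for x
      using frechet_derivative_at[OF d[OF that]] by metis
  qed
  with d show ?case by (auto simp: differentiable_def)
qed

lemma Ck_on_sum:
  assumes "open U" "\<And>i. i \<in> I \<Longrightarrow> Ck_on k (f i) U"
  shows "Ck_on k (\<lambda>x. \<Sum>i\<in>I. f i x) U"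
  using assms(2)
  by (induction I rule: infinite_finite_induct) (auto intro: Ck_on_const Ck_on_add[OF assms(1)])

text \<open>The derivative of \<open>f\<close> at \<open>u x\<close> has to be applied to a vector
  that itself depends on \<open>x\<close>. Expanding this vector in coordinates gives a sum of
  products of scalar functions, in which each partial derivative of \<open>f\<close> is again
  composed with the same \<open>u\<close>; the induction hypothesis applies to these.\<close>

lemma Ck_on_compose:
  fixes f :: "real ^ 'n::finite \<Rightarrow> real" and u :: "'a::real_normed_vector \<Rightarrow> real ^ 'n"
  assumes "open U" "Ck_on k f UNIV" "Ck_on k u U"
  shows "Ck_on k (\<lambda>x. f (u x)) U"
  using assms(2,3)
proof (induction k arbitrary: f)
  case 0
  then show ?case by (auto intro: continuous_on_compose2)
next
  case (Suc k)
  have d: "((\<lambda>x. f (u x)) has_derivative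
      (\<lambda>v. frechet_derivative f (at (u x)) (frechet_derivative u (at x) v))) (at x)"
    if "x \<in> U" for x
  proof -
    have "f differentiable (at (u x))" "u differentiable (at x)"
      using Suc.prems that by auto
    then have "(f has_derivative frechet_derivative f (at (u x))) (at (u x))"
        "(u has_derivative frechet_derivative u (at x)) (at x)"
      using frechet_derivative_works by blast+
    then show ?thesis by (rule has_derivative_compose[rotated])
  qed
  have "Ck_on k (\<lambda>x. frechet_derivative (\<lambda>x. f (u x)) (at x) v) U" for v
  proof (rule Ck_on_cong[OF assms(1)])
    show "Ck_on k (\<lambda>x. \<Sum>i\<in>UNIV. (frechet_derivative u (at x) v $ i) *
        frechet_derivative f (at (u x)) (axis i 1)) U"
    proof (intro Ck_on_sum[OF assms(1)] Ck_on_mult[OF assms(1)])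
      show "Ck_on k (\<lambda>x. frechet_derivative u (at x) v $ i) U" for i
        using Suc.prems(2) by (intro Ck_on_bounded_linear[OF assms(1) bounded_linear_vec_nth]) simp
      show "Ck_on k (\<lambda>x. frechet_derivative f (at (u x)) (axis i 1)) U" for i
        using Suc.prems by (intro Suc.IH) (auto dest: Ck_on_Suc_imp_Ck_on simp del: Ck_on.simps(2)
            simp: Ck_on.simps(2)[of k f])
    qed
    show "(\<Sum>i\<in>UNIV. (frechet_derivative u (at x) v $ i) *
        frechet_derivative f (at (u x)) (axis i 1)) = frechet_derivative (\<lambda>x. f (u x)) (at x) v"
      if "x \<in> U" for x
    proof -
      have "linear (frechet_derivative f (at (u x)))"
        using Suc.prems(1) by (intro linear_frechet_derivative) auto
      then have "(\<Sum>i\<in>UNIV. (frechet_derivative u (at x) v $ i) *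
          frechet_derivative f (at (u x)) (axis i 1))
        = frechet_derivative f (at (u x))
            (\<Sum>i\<in>UNIV. (frechet_derivative u (at x) v $ i) *\<^sub>R axis i 1)"
        by (simp add: linear_sum linear_scale)
      also have "(\<Sum>i\<in>UNIV. (frechet_derivative u (at x) v $ i) *\<^sub>R axis i 1)
          = frechet_derivative u (at x) v"
        by (simp add: vec_eq_iff axis_def if_distrib cong: if_cong)
      finally show ?thesis
        using frechet_derivative_at[OF d[OF that]] by metis
    qed
  qed
  with d show ?case by (auto simp: differentiable_def)
qed

section \<open>Directional derivatives, as operators on functions that can be iterated\<close>

definition dir_deriv ::
  "'a::real_normed_vector \<Rightarrow> ('a \<Rightarrow> 'b::real_normed_vector) \<Rightarrow> 'a \<Rightarrow> 'b" where
  "dir_deriv v f = (\<lambda>x. frechet_derivative f (at x) v)"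

lemma smooth_on_dir_deriv: "smooth_on f U \<Longrightarrow> smooth_on (dir_deriv v f) U"
  unfolding smooth_on_def dir_deriv_def
proof
  fix k assume "\<forall>k. Ck_on k f U"
  then have "Ck_on (Suc k) f U" by blast
  then show "Ck_on k (\<lambda>x. frechet_derivative f (at x) v) U" by simp
qed

lemma smooth_on_const: "smooth_on (\<lambda>x. a) U"
  by (simp add: smooth_on_def Ck_on_const)

lemma smooth_on_add:
  "open U \<Longrightarrow> smooth_on f U \<Longrightarrow> smooth_on g U \<Longrightarrow> smooth_on (\<lambda>x. f x + g x) U"
  by (simp add: smooth_on_def Ck_on_add)

lemma smooth_on_cmult:
  fixes f :: "'a::real_normed_vector \<Rightarrow> real"
  shows "open U \<Longrightarrow> smooth_on f U \<Longrightarrow> smooth_on (\<lambda>x. a * f x) U"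
  by (simp add: smooth_on_def Ck_on_mult Ck_on_const)

lemma smooth_on_diff:
  fixes f g :: "'a::real_normed_vector \<Rightarrow> real"
  shows "open U \<Longrightarrow> smooth_on f U \<Longrightarrow> smooth_on g U \<Longrightarrow> smooth_on (\<lambda>x. f x - g x) U"
  using smooth_on_add[of U f "\<lambda>x. -1 * g x"] smooth_on_cmult[of U g "-1"] by simp

lemma smooth_on_sum:
  "open U \<Longrightarrow> (\<And>i. i \<in> I \<Longrightarrow> smooth_on (f i) U) \<Longrightarrow> smooth_on (\<lambda>x. \<Sum>i\<in>I. f i x) U"
  by (simp add: smooth_on_def Ck_on_sum)

lemma smooth_on_compose:
  fixes f :: "real ^ 'n::finite \<Rightarrow> real" and u :: "'a::real_normed_vector \<Rightarrow> real ^ 'n"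
  shows "open U \<Longrightarrow> smooth_on f UNIV \<Longrightarrow> smooth_on u U \<Longrightarrow> smooth_on (\<lambda>x. f (u x)) U"
  by (simp add: smooth_on_def Ck_on_compose)

lemma smooth_on_vec_nth:
  fixes f :: "'a::real_normed_vector \<Rightarrow> real ^ 'n::finite"
  shows "open U \<Longrightarrow> smooth_on f U \<Longrightarrow> smooth_on (\<lambda>x. f x $ i) U"
  by (simp add: smooth_on_def Ck_on_bounded_linear[OF _ bounded_linear_vec_nth])

lemma dir_deriv_sum_dir:
  assumes "f differentiable (at p)"
  shows "dir_deriv (\<Sum>i\<in>I. a i *\<^sub>R v i) f p = (\<Sum>i\<in>I. a i *\<^sub>R dir_deriv (v i) f p)"
  unfolding dir_deriv_def
  using linear_frechet_derivative[OF assms] by (simp add: linear_sum linear_scale)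

lemma dir_deriv_sum:
  fixes f :: "'i \<Rightarrow> 'a::real_normed_vector \<Rightarrow> real"
  assumes "finite I" "\<And>i. i \<in> I \<Longrightarrow> f i differentiable (at p)"
  shows "dir_deriv v (\<lambda>p. \<Sum>i\<in>I. a i * f i p) p = (\<Sum>i\<in>I. a i * dir_deriv v (f i) p)"
proof -
  have "((\<lambda>p. \<Sum>i\<in>I. a i * f i p) has_derivative
      (\<lambda>v. \<Sum>i\<in>I. a i * frechet_derivative (f i) (at p) v)) (at p)"
    by (intro has_derivative_sum has_derivative_mult_right
        iffD1[OF frechet_derivative_works] assms(2))
  then show ?thesis
    by (simp only: dir_deriv_def frechet_derivative_at[symmetric])
qed

lemma dir_deriv_add:
  assumes "f differentiable (at p)" "g differentiable (at p)"
  shows "dir_deriv v (\<lambda>p. f p + g p) p = dir_deriv v f p + dir_deriv v g p"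
proof -
  have "((\<lambda>p. f p + g p) has_derivative
      (\<lambda>v. frechet_derivative f (at p) v + frechet_derivative g (at p) v)) (at p)"
    by (intro has_derivative_add iffD1[OF frechet_derivative_works] assms)
  then show ?thesis
    by (simp only: dir_deriv_def frechet_derivative_at[symmetric])
qed

lemma dir_deriv_const [simp]: "dir_deriv v (\<lambda>p. a) p = 0"
  by (simp add: dir_deriv_def)

lemma dir_deriv_0_dir:
  assumes "f differentiable (at p)"
  shows "dir_deriv 0 f p = 0"
  using linear_frechet_derivative[OF assms] by (simp add: dir_deriv_def linear_0)

lemma smooth_on_dir_deriv_power: "smooth_on f U \<Longrightarrow> smooth_on ((dir_deriv v ^^ m) f) U"
  by (induction m) (auto simp: smooth_on_dir_deriv)

lemma dir_deriv_cong:
  assumes "open U" "\<And>y. y \<in> U \<Longrightarrow> f y = g y" "p \<in> U"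
  shows "dir_deriv v f p = dir_deriv v g p"
  using frechet_derivative_cong_open[OF assms(1,3,2)] by (simp add: dir_deriv_def)

lemma dir_deriv_cmult:
  fixes f :: "'a::real_normed_vector \<Rightarrow> real"
  assumes "f differentiable (at p)"
  shows "dir_deriv v (\<lambda>p. a * f p) p = a * dir_deriv v f p"
  using dir_deriv_sum[of "{()}" "\<lambda>_. f" p v "\<lambda>_. a"] assms by simp

text \<open>Space shifts move by \<open>- h\<close> times a velocity, while the Taylor estimate
  below only moves forward. It is therefore used along the opposite vector, and this lemma restores
  the velocity itself, producing the alternating signs of exp(-hG).\<close>

lemma dir_deriv_minus_power:
  fixes f :: "'a::real_normed_vector \<Rightarrow> real"
  assumes "open U" "smooth_on f U" "p \<in> U"
  shows "(dir_deriv (- v) ^^ m) f p = (- 1) ^ m * (dir_deriv v ^^ m) f p"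
  using assms(3)
proof (induction m arbitrary: p)
  case 0
  then show ?case by simp
next
  case (Suc m)
  have d: "(dir_deriv v ^^ m) f differentiable (at p)"
    using smooth_on_imp_differentiable[OF smooth_on_dir_deriv_power[OF assms(2)] Suc.prems] .
  have "(dir_deriv (- v) ^^ Suc m) f p = dir_deriv (- v) (\<lambda>p. (- 1) ^ m * (dir_deriv v ^^ m) f p) p"
    unfolding funpow.simps comp_apply by (rule dir_deriv_cong[OF assms(1) Suc.IH Suc.prems])
  also have "\<dots> = (- 1) ^ m * dir_deriv (- v) ((dir_deriv v ^^ m) f) p"
    by (rule dir_deriv_cmult[OF d])
  also have "dir_deriv (- v) ((dir_deriv v ^^ m) f) p = - dir_deriv v ((dir_deriv v ^^ m) f) p"
    using linear_neg[OF linear_frechet_derivative[OF d], of v]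
    by (simp only: dir_deriv_def[of _ "(dir_deriv v ^^ m) f"])
  finally show ?case by simp
qed

lemma has_real_derivative_dir_deriv:
  fixes f :: "'a::real_normed_vector \<Rightarrow> real"
  assumes "f differentiable (at (p + h *\<^sub>R v))"
  shows "((\<lambda>h. f (p + h *\<^sub>R v)) has_real_derivative dir_deriv v f (p + h *\<^sub>R v)) (at h)"
proof -
  have 1: "((\<lambda>h. p + h *\<^sub>R v) has_derivative (\<lambda>k. k *\<^sub>R v)) (at h)"
    by (auto intro!: derivative_eq_intros)
  have "(f has_derivative frechet_derivative f (at (p + h *\<^sub>R v))) (at (p + h *\<^sub>R v))"
    using assms frechet_derivative_works by blast
  from has_derivative_compose[OF 1 this]
  have "((\<lambda>h. f (p + h *\<^sub>R v)) has_derivative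
      (\<lambda>k. frechet_derivative f (at (p + h *\<^sub>R v)) (k *\<^sub>R v))) (at h)" .
  moreover have "frechet_derivative f (at (p + h *\<^sub>R v)) (k *\<^sub>R v)
      = dir_deriv v f (p + h *\<^sub>R v) * k" for k
    using linear_frechet_derivative[OF assms] by (simp add: dir_deriv_def linear_scale)
  ultimately show ?thesis by (simp add: has_field_derivative_def)
qed

text \<open>The Lagrange form of the remainder is taken along the segment from \<open>p\<close>. All
  such segments together form the image \<open>?L\<close> of a compact set, on which the continuous
  derivative of order \<open>n\<close> is bounded; this makes \<open>C\<close> independent of
  \<open>p\<close> and \<open>h\<close>.\<close>

lemma taylor_uniform:
  fixes f :: "'a::real_normed_vector \<Rightarrow> real"
  assumes "smooth_on f U" "compact K" "n > 0"
    and seg: "\<And>p h. p \<in> K \<Longrightarrow> 0 \<le> h \<Longrightarrow> h \<le> H \<Longrightarrow> p + h *\<^sub>R v \<in> U"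
  obtains C where "\<And>p h. p \<in> K \<Longrightarrow> 0 < h \<Longrightarrow> h \<le> H \<Longrightarrow>
    \<bar>f (p + h *\<^sub>R v) - (\<Sum>m<n. (dir_deriv v ^^ m) f p / fact m * h ^ m)\<bar> \<le> C * h ^ n"
proof -
  have sm: "smooth_on ((dir_deriv v ^^ m) f) U" for m
    by (rule smooth_on_dir_deriv_power[OF assms(1)])
  let ?L = "(\<lambda>(p, h). p + h *\<^sub>R v) ` (K \<times> {0..H})"
  have "compact ?L"
    using assms(2) by (intro compact_continuous_image compact_Times)
      (auto intro!: continuous_intros simp: case_prod_unfold)
  moreover have "continuous_on ?L ((dir_deriv v ^^ n) f)"
    using seg by (intro continuous_on_subset[OF smooth_on_imp_continuous_on[OF sm]]) auto
  ultimately have "compact ((dir_deriv v ^^ n) f ` ?L)"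
    by (rule compact_continuous_image[rotated])
  then have "bounded ((dir_deriv v ^^ n) f ` ?L)"
    by (rule compact_imp_bounded)
  then obtain C where "\<forall>y\<in>(dir_deriv v ^^ n) f ` ?L. \<bar>y\<bar> \<le> C"
    unfolding bounded_iff real_norm_def by blast
  from bspec[OF this imageI] have C: "\<bar>(dir_deriv v ^^ n) f q\<bar> \<le> C" if "q \<in> ?L" for q
    using that by blast
  show thesis
  proof (rule that[of "C / fact n"])
    fix p h assume p: "p \<in> K" and h: "0 < h" "h \<le> H"
    have "\<exists>t>0. t < h \<and> f (p + h *\<^sub>R v) =
        (\<Sum>m<n. (dir_deriv v ^^ m) f (p + 0 *\<^sub>R v) / fact m * h ^ m)
          + (dir_deriv v ^^ n) f (p + t *\<^sub>R v) / fact n * h ^ n"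
    proof (rule Maclaurin[OF h(1) assms(3), where diff = "\<lambda>m h. (dir_deriv v ^^ m) f (p
        + h *\<^sub>R v)"])
      show "\<forall>m t. m < n \<and> 0 \<le> t \<and> t \<le> h \<longrightarrow>
        ((\<lambda>h. (dir_deriv v ^^ m) f (p + h *\<^sub>R v)) has_real_derivative
           (dir_deriv v ^^ Suc m) f (p + t *\<^sub>R v)) (at t)"
      proof (intro allI impI)
        fix m t assume "m < n \<and> 0 \<le> t \<and> t \<le> h"
        then have "p + t *\<^sub>R v \<in> U" using seg[OF p] h by auto
        from has_real_derivative_dir_deriv[OF smooth_on_imp_differentiable[OF sm this]]
        show "((\<lambda>h. (dir_deriv v ^^ m) f (p + h *\<^sub>R v)) has_real_derivative
           (dir_deriv v ^^ Suc m) f (p + t *\<^sub>R v)) (at t)" by simp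
      qed
    qed simp
    then obtain t where t: "0 < t" "t < h" and eq: "f (p + h *\<^sub>R v) =
        (\<Sum>m<n. (dir_deriv v ^^ m) f p / fact m * h ^ m)
          + (dir_deriv v ^^ n) f (p + t *\<^sub>R v) / fact n * h ^ n"
      by auto
    have "p + t *\<^sub>R v \<in> ?L"
      using p t h by (intro image_eqI[of _ _ "(p, t)"]) auto
    from C[OF this] have "\<bar>(dir_deriv v ^^ n) f (p + t *\<^sub>R v)\<bar> * (h ^ n / fact n)
        \<le> C * (h ^ n / fact n)"
      using h by (intro mult_right_mono) auto
    then show "\<bar>f (p + h *\<^sub>R v) - (\<Sum>m<n. (dir_deriv v ^^ m) f p / fact m * h ^ m)\<bar>
        \<le> C / fact n * h ^ n"
      using h unfolding eq by (simp add: abs_mult)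
  qed
qed

section \<open>The residual in terms of the defect of the scheme\<close>

lemma sum_UNIV_sum_type:
  fixes f :: "'a::finite + 'b::finite \<Rightarrow> 'c::comm_monoid_add"
  shows "(\<Sum>l\<in>UNIV. f l) = (\<Sum>i\<in>UNIV. f (Inl i)) + (\<Sum>j\<in>UNIV. f (Inr j))"
  by (simp add: UNIV_Plus_UNIV[symmetric] sum.Plus del: UNIV_Plus_UNIV)

lemma fd_apply_sum_fun:
  "fd_apply dx D (\<lambda>y. \<Sum>k\<in>I. f k y) x = (\<Sum>k\<in>I. fd_apply dx D (f k) x)"
  unfolding fd_apply_def sum_distrib_left by (rule sum.swap)

lemma fd_apply_cmult_fun: "fd_apply dx D (\<lambda>y. a * f y) x = a * fd_apply dx D f x"
  by (simp add: fd_apply_def sum_distrib_left mult.left_commute)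

lemma fd_apply_sum: "fd_apply dx (\<Sum>k\<in>I. D k) f x = (\<Sum>k\<in>I. fd_apply dx (D k) f x)"
  by (induction I rule: infinite_finite_induct) (auto simp: fd_apply_add)

lemma fd_apply_const: "fd_apply dx (fd_const a) f x = a * f x"
  by (simp add: fd_const_def fd_apply_single lattice_vec_def vec_eq_iff[symmetric]
      zero_vec_def[symmetric])

lemma fd_apply_1: "fd_apply dx 1 f x = f x"
  using fd_apply_const[of dx 1] by (simp add: fd_const_def)

text \<open>Coefficients beyond the degree vanish, so polynomials of different degrees can be summed
  over one common range.\<close>

lemma st_apply_eq_sum:
  assumes "degree P \<le> n"
  shows "st_apply dx dt P f (t, x) =
    (\<Sum>k\<le>n. fd_apply dx (coeff P k) (\<lambda>y. f (t + real k * dt, y)) x)"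
  unfolding st_apply_def prod.case using assms
  by (intro sum.mono_neutral_left) (auto simp: coeff_eq_0 not_le)

lemma st_apply_add: "st_apply dx dt (P + Q) f p = st_apply dx dt P f p + st_apply dx dt Q f p"
proof (cases p)
  case (Pair t x)
  let ?n = "max (degree P) (degree Q)"
  have "degree (P + Q) \<le> ?n" by (rule degree_add_le_max)
  then show ?thesis
    unfolding Pair by (simp add: st_apply_eq_sum[of _ ?n] fd_apply_add sum.distrib)
qed

lemma st_apply_0: "st_apply dx dt 0 f p = 0"
  by (cases p) (simp add: st_apply_def)

lemma st_apply_sum: "st_apply dx dt (\<Sum>k\<in>I. P k) f p = (\<Sum>k\<in>I. st_apply dx dt (P k) f p)"
  by (induction I rule: infinite_finite_induct) (auto simp: st_apply_add st_apply_0)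

lemma st_apply_diff: "st_apply dx dt (P - Q) f p = st_apply dx dt P f p - st_apply dx dt Q f p"
  using st_apply_add[of dx dt "P - Q" Q f p] by simp

lemma st_apply_sum_fun:
  "st_apply dx dt P (\<lambda>p. \<Sum>k\<in>I. f k p) p = (\<Sum>k\<in>I. st_apply dx dt P (f k) p)"
  by (cases p) (simp add: st_apply_def fd_apply_sum_fun sum.swap[of _ I])

lemma st_apply_add_fun:
  "st_apply dx dt P (\<lambda>p. f p + g p) p = st_apply dx dt P f p + st_apply dx dt P g p"
  by (cases p) (simp add: st_apply_def fd_apply_add_fun sum.distrib)

lemma st_apply_diff_fun:
  "st_apply dx dt P (\<lambda>p. f p - g p) p = st_apply dx dt P f p - st_apply dx dt P g p"
  using st_apply_add_fun[of dx dt P "\<lambda>p. f p - g p" g p] by simp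

text \<open>Horner form: \<open>pCons a P\<close> is a + zP, and the factor z moves the evaluation
  of \<open>P\<close> one time step ahead.\<close>

lemma st_apply_pCons:
  "st_apply dx dt (pCons a P) f (t, x) =
     fd_apply dx a (\<lambda>y. f (t, y)) x + st_apply dx dt P f (t + dt, x)"
proof -
  have "st_apply dx dt (pCons a P) f (t, x) =
      (\<Sum>k\<le>Suc (degree P). fd_apply dx (coeff (pCons a P) k) (\<lambda>y. f (t + real k * dt, y)) x)"
    by (rule st_apply_eq_sum) (rule degree_pCons_le)
  also have "\<dots> = fd_apply dx a (\<lambda>y. f (t, y)) x + st_apply dx dt P f (t + dt, x)"
    unfolding sum.atMost_Suc_shift st_apply_def by (simp add: algebra_simps)
  finally show ?thesis .
qed

lemma st_apply_const_poly: "st_apply dx dt [:a:] f (t, x) = fd_apply dx a (\<lambda>y. f (t, y)) x"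
  by (simp add: st_apply_pCons st_apply_0)

lemma st_apply_smult:
  "st_apply dx dt (smult a P) f (t, x) = fd_apply dx a (\<lambda>y. st_apply dx dt P f (t, y)) x"
  by (simp add: st_apply_eq_sum[of _ "degree P"] degree_smult_le fd_apply_mult fd_apply_sum_fun)

text \<open>Functions thus become a module over the polynomials in the time shift, so that matrix
  identities over this ring can be applied to functions. The point \<open>p\<close> is generalized
  in the induction because z changes the time.\<close>

lemma st_apply_mult: "st_apply dx dt (P * Q) f p = st_apply dx dt P (st_apply dx dt Q f) p"
proof (induction P arbitrary: p)
  case 0
  show ?case by (simp add: st_apply_0)
next
  case (pCons a P)
  then show ?case
    by (cases p) (simp add: mult_pCons_left st_apply_add st_apply_smult st_apply_pCons)
qed

section \<open>The adjugate as a left multiplier\<close>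

lemma transpose_cofactor_matrix: "cofactor_matrix (transpose X) = transpose (cofactor_matrix X)"
proof -
  have "det (\<chi> k l. if k = i \<and> l = j then 1 else if k = i \<or> l = j then 0 else transpose X $ k $ l)
      = det (\<chi> k l. if k = j \<and> l = i then 1 else if k = j \<or> l = i then 0 else X $ k $ l)" for i j
    by (subst det_transpose[symmetric])
       (auto simp: transpose_def intro!: arg_cong[where f = det] simp: vec_eq_iff)
  then have "cofactor_matrix (transpose X) $ i $ j = cofactor_matrix X $ j $ i" for i j
    by (simp add: cofactor_matrix_def)
  then show ?thesis
    by (simp add: vec_eq_iff transpose_def[of "cofactor_matrix X"])
qed

text \<open>Transposition turns \<open>matrix_mult_adjugate\<close> for the transposed matrix into
  the identity with the adjugate on the left, which is the side on which the elimination
  multiplies.\<close>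

lemma adjugate_matrix_mult:
  fixes X :: "'a::comm_ring_1 ^ 'q::finite ^ 'q"
  shows "adjugate X ** X = mat (det X)"
proof -
  have "transpose (adjugate X ** X) = transpose X ** adjugate (transpose X)"
    by (simp add: matrix_transpose_mul adjugate_def transpose_cofactor_matrix)
  also have "\<dots> = mat (det X)"
    by (simp add: matrix_mult_adjugate det_transpose)
  finally have "transpose (transpose (adjugate X ** X)) = mat (det X)"
    by simp
  then show ?thesis by (simp only: transpose_transpose)
qed

lemma fd_const_0 [simp]: "fd_const 0 = 0"
  by (simp add: fd_const_def)

lemma lbm_A_nth: "lbm_A c M s $ j $ l = lbm_T c M $ j $ l * fd_const (1 - s $ l)"
  unfolding lbm_A_def matrix_matrix_mult_def
  by (simp add: map_matrix_def diag_matrix_def mat_def if_distrib[of "\<lambda>x. a * fd_const x" for a]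
        if_distrib[of fd_const] if_distrib[of "(*) a" for a] if_distrib[of "(-) a"
            for a] if_distribR cong: if_cong)

lemma lbm_B_nth: "lbm_B c M s $ j $ l = lbm_T c M $ j $ l * fd_const (s $ l)"
  unfolding lbm_B_def matrix_matrix_mult_def
  by (simp add: map_matrix_def diag_matrix_def if_distrib[of fd_const]
        if_distrib[of "(*) a" for a] cong: if_cong)

lemma fd_apply_lbm_T:
  "fd_apply dx (lbm_T c M $ j $ l) f x =
     (\<Sum>a\<in>UNIV. M $ j $ a * matrix_inv M $ a $ l * f (x - dx *\<^sub>R lattice_vec (c a)))"
proof -
  have "lbm_T c M $ j $ l = (\<Sum>a\<in>UNIV. fd_const (M $ j $ a) * space_shift (c a) * fd_const
      (matrix_inv M $ a $ l))"
    unfolding lbm_T_def matrix_matrix_mult_def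
    by (simp add: map_matrix_def diag_matrix_def if_distrib[of "(*) a" for a] cong: if_cong)
  then show ?thesis
    by (simp add: fd_apply_sum fd_apply_mult fd_apply_const fd_apply_single space_shift_def
        mult.assoc mult.left_commute)
qed

text \<open>This is row \<open>j\<close> of z m - A m - B e, written as collision followed by
  transport: relaxation is diagonal, so A m + B e is T applied to the post-collision moments. The
  fields \<open>m\<close> and \<open>e\<close> are independent arguments.\<close>

definition lbm_defect ::
  "('q \<Rightarrow> int ^ 'd::finite) \<Rightarrow> real ^ 'q ^ 'q \<Rightarrow> real ^ 'q::finite \<Rightarrow> real \<Rightarrow> real
     \<Rightarrow> ('q \<Rightarrow> real \<times> (real ^ 'd) \<Rightarrow> real) \<Rightarrow> ('q \<Rightarrow> real \<times> (real ^ 'd) \<Rightarrow> real)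
     \<Rightarrow> 'q \<Rightarrow> real \<times> (real ^ 'd) \<Rightarrow> real" where
  "lbm_defect c M s dx dt m e j = (\<lambda>(t, x). m j (t + dt, x) -
     (\<Sum>l\<in>UNIV. fd_apply dx (lbm_T c M $ j $ l)
        (\<lambda>y. (1 - s $ l) * m l (t, y) + s $ l * e l (t, y)) x))"

text \<open>Writing zI - A as Z minus the diamond part and multiplying by row \<open>i\<close> of
  adj(Z) leaves det(Z) on the moment \<open>Inl i\<close>. The assumption fixes only the conserved
  components of \<open>m\<close>, since the coefficients of the others cancel.\<close>

lemma fd_residual_eq_defect:
  fixes c :: "('n::finite + 'k::finite) \<Rightarrow> int ^ 'd::finite"
  assumes m: "\<And>i. m (Inl i) = (\<lambda>p. u p $ i)"
  shows "fd_residual c M s meq dx dt i u p =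
    (\<Sum>j\<in>UNIV. st_apply dx dt (adjugate (fd_char_matrix c M s i) $ Inl i $ j)
       (lbm_defect c M s dx dt m (\<lambda>l p. meq (u p) $ l) j) p)"
proof -
  let ?Z = "fd_char_matrix c M s i"
  let ?J = "adjugate ?Z"
  let ?A = "map_matrix (\<lambda>a. [:a:]) (lbm_A_diamond c M s i)"
  let ?B = "map_matrix (\<lambda>a. [:a:]) (lbm_B c M s)"
  let ?e = "\<lambda>l p. meq (u p) $ l"
  have coll: "fd_apply dx (lbm_T c M $ j $ l) (\<lambda>y. (1 - s $ l) * m l (t, y) + s $ l * ?e l (t, y)) x
      = fd_apply dx (lbm_A c M s $ j $ l) (\<lambda>y. m l (t, y)) x
        + fd_apply dx (lbm_B c M s $ j $ l) (\<lambda>y. ?e l (t, y)) x" for j l t x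
    by (simp add: lbm_A_nth lbm_B_nth fd_apply_mult fd_apply_add_fun fd_apply_const[abs_def])
  \<comment> \<open>The kept block and the diamond part add up to A, so this difference is zI - A
    whatever \<open>i\<close> is.\<close>
  have ZA: "(?Z - ?A) $ j $ l = (if j = l then [:0, 1:] else 0) - [:lbm_A c M s $ j $ l:]" for j l
    by (simp add: fd_char_matrix_def lbm_A_diamond_def map_matrix_def mat_def)
  have defect: "lbm_defect c M s dx dt m ?e j q =
      (\<Sum>l\<in>UNIV. st_apply dx dt ((?Z - ?A) $ j $ l) (m l) q)
      - (\<Sum>l\<in>UNIV. st_apply dx dt (?B $ j $ l) (?e l) q)" for j q
  proof (cases q)
    case (Pair t x)
    have "(\<Sum>l\<in>UNIV. st_apply dx dt ((?Z - ?A) $ j $ l) (m l) (t, x))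
      = (\<Sum>l\<in>UNIV. (if j = l then m l (t + dt, x) else 0)
          - fd_apply dx (lbm_A c M s $ j $ l) (\<lambda>y. m l (t, y)) x)"
      unfolding ZA st_apply_diff st_apply_const_poly
      by (intro sum.cong) (auto simp: st_apply_pCons st_apply_0 fd_apply_1)
    then show ?thesis
      unfolding Pair lbm_defect_def coll
      by (simp add: sum_subtractf sum.distrib map_matrix_def st_apply_const_poly)
  qed
  have "(\<Sum>j\<in>UNIV. st_apply dx dt (?J $ Inl i $ j) (lbm_defect c M s dx dt m ?e j) p)
    = (\<Sum>l\<in>UNIV. st_apply dx dt ((?J ** (?Z - ?A)) $ Inl i $ l) (m l) p)
      - (\<Sum>l\<in>UNIV. st_apply dx dt ((?J ** ?B) $ Inl i $ l) (?e l) p)"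
  proof -
    \<comment> \<open>By \<open>st_apply_mult\<close>, applying the adjugate row to row sums is the
      action of a matrix product. The matrix \<open>X\<close> is arbitrary because this serves both
      the moment part and the equilibrium part.\<close>
    have "(\<Sum>j\<in>UNIV. st_apply dx dt (?J $ Inl i $ j)
          (\<lambda>q. \<Sum>l\<in>UNIV. st_apply dx dt (X $ j $ l) (f l) q) p)
        = (\<Sum>l\<in>UNIV. st_apply dx dt ((?J ** X) $ Inl i $ l) (f l) p)"
      for X :: "'d fd_op poly ^ ('n + 'k) ^ ('n + 'k)" and f
      unfolding st_apply_sum_fun
      by (subst sum.swap) (simp add: matrix_matrix_mult_def st_apply_sum st_apply_mult)
    then show ?thesis
      unfolding defect[abs_def] st_apply_diff_fun sum_subtractf by (simp only:)
  qed
  also have "?J ** (?Z - ?A) = mat (det ?Z) - ?J ** ?A"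
  proof -
    have "?J ** (?Z - ?A) = ?J ** ?Z - ?J ** ?A"
      by (simp add: matrix_matrix_mult_def vec_eq_iff right_diff_distrib sum_subtractf)
    then show ?thesis by (simp add: adjugate_matrix_mult)
  qed
  also have "(\<Sum>l\<in>UNIV. st_apply dx dt ((mat (det ?Z) - ?J ** ?A) $ Inl i $ l) (m l) p)
     = st_apply dx dt (det ?Z) (m (Inl i)) p
       - (\<Sum>l\<in>UNIV. st_apply dx dt ((?J ** ?A) $ Inl i $ l) (m l) p)"
  proof -
    have "(\<Sum>l\<in>UNIV. st_apply dx dt (mat (det ?Z) $ Inl i $ l) (m l) p)
        = (\<Sum>l\<in>UNIV. if Inl i = l then st_apply dx dt (det ?Z) (m l) p else 0)"
      by (intro sum.cong) (auto simp: mat_def st_apply_0)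
    then show ?thesis by (simp add: st_apply_diff sum_subtractf)
  qed
  also have "(\<Sum>l\<in>UNIV. st_apply dx dt ((?J ** ?A) $ Inl i $ l) (m l) p)
      = (\<Sum>l\<in>UNIV. st_apply dx dt ((?J ** ?A) $ Inl i $ Inl l) (m (Inl l)) p)"
    by (simp add: sum_UNIV_sum_type nonconserved_coefficient_zero st_apply_0)
  finally show ?thesis
    unfolding fd_residual_def Let_def m by simp
qed

section \<open>Locally uniform remainders\<close>

text \<open>Uniformity on compact sets is what survives an FD operator, which evaluates its argument
  at points moving with \<open>h\<close>; a pointwise order would not suffice. The bound
  \<open>h \<le> 1\<close> keeps these points in a compact set and makes higher orders
  stronger.\<close>

definition unif_O :: "'a::topological_space set \<Rightarrow> nat \<Rightarrow> (real \<Rightarrow> 'a \<Rightarrow> real) \<Rightarrow> bool" where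
  "unif_O U n F \<longleftrightarrow> (\<forall>K. compact K \<and> K \<subseteq> U \<longrightarrow>
     (\<exists>C. \<forall>h p. 0 < h \<and> h \<le> 1 \<and> p \<in> K \<longrightarrow> \<bar>F h p\<bar> \<le> C * h ^ n))"

lemma unif_OI:
  assumes "\<And>K. compact K \<Longrightarrow> K \<subseteq> U \<Longrightarrow>
    \<exists>C. \<forall>h p. 0 < h \<and> h \<le> 1 \<and> p \<in> K \<longrightarrow> \<bar>F h p\<bar> \<le> C * h ^ n"
  shows "unif_O U n F"
  using assms unfolding unif_O_def by blast

lemma unif_OE:
  assumes "unif_O U n F" "compact K" "K \<subseteq> U"
  obtains C where "\<And>h p. 0 < h \<Longrightarrow> h \<le> 1 \<Longrightarrow> p \<in> K \<Longrightarrow> \<bar>F h p\<bar> \<le> C * h ^ n"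
  using assms unfolding unif_O_def by meson

lemma unif_O_cong:
  assumes "unif_O U n F" "\<And>h p. 0 < h \<Longrightarrow> h \<le> 1 \<Longrightarrow> p \<in> U \<Longrightarrow> F h p = G h p"
  shows "unif_O U n G"
proof (rule unif_OI)
  fix K assume K: "compact K" "K \<subseteq> U"
  obtain C where
    "\<And>h p. 0 < h \<Longrightarrow> h \<le> 1 \<Longrightarrow> p \<in> K \<Longrightarrow> \<bar>F h p\<bar> \<le> C * h ^ n"
    using unif_OE[OF assms(1) K] by blast
  with K(2) assms(2) show "\<exists>C. \<forall>h p. 0 < h \<and> h \<le> 1 \<and> p \<in> K \<longrightarrow> \<bar>G h p\<bar> \<le> C * h ^ n"
    by (intro exI[of _ C]) (metis (full_types) subsetD)
qed

lemma unif_O_0: "unif_O U n (\<lambda>h p. 0)"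
  by (rule unif_OI) (auto intro: exI[of _ 0])

lemma unif_O_add:
  assumes "unif_O U n F" "unif_O U n G"
  shows "unif_O U n (\<lambda>h p. F h p + G h p)"
proof (rule unif_OI)
  fix K assume K: "compact K" "K \<subseteq> U"
  obtain C where
    C: "\<And>h p. 0 < h \<Longrightarrow> h \<le> 1 \<Longrightarrow> p \<in> K \<Longrightarrow> \<bar>F h p\<bar> \<le> C * h ^ n"
    using unif_OE[OF assms(1) K] by blast
  obtain D where
    D: "\<And>h p. 0 < h \<Longrightarrow> h \<le> 1 \<Longrightarrow> p \<in> K \<Longrightarrow> \<bar>G h p\<bar> \<le> D * h ^ n"
    using unif_OE[OF assms(2) K] by blast
  show "\<exists>C. \<forall>h p. 0 < h \<and> h \<le> 1 \<and> p \<in> K \<longrightarrow> \<bar>F h p + G h p\<bar> \<le> C * h ^ n"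
  proof (intro exI allI impI)
    fix h :: real and p assume "0 < h \<and> h \<le> 1 \<and> p \<in> K"
    with C[of h p] D[of h p] show "\<bar>F h p + G h p\<bar> \<le> (C + D) * h ^ n"
      unfolding distrib_right by linarith
  qed
qed

lemma unif_O_cmult:
  assumes "unif_O U n F"
  shows "unif_O U n (\<lambda>h p. a * F h p)"
proof (rule unif_OI)
  fix K assume K: "compact K" "K \<subseteq> U"
  obtain C where
    C: "\<And>h p. 0 < h \<Longrightarrow> h \<le> 1 \<Longrightarrow> p \<in> K \<Longrightarrow> \<bar>F h p\<bar> \<le> C * h ^ n"
    using unif_OE[OF assms K] by blast
  show "\<exists>C. \<forall>h p. 0 < h \<and> h \<le> 1 \<and> p \<in> K \<longrightarrow> \<bar>a * F h p\<bar> \<le> C * h ^ n"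
  proof (intro exI allI impI)
    fix h :: real and p assume "0 < h \<and> h \<le> 1 \<and> p \<in> K"
    with C[of h p] have "\<bar>a\<bar> * \<bar>F h p\<bar> \<le> \<bar>a\<bar> * (C * h ^ n)"
      by (intro mult_left_mono) auto
    then show "\<bar>a * F h p\<bar> \<le> (\<bar>a\<bar> * C) * h ^ n"
      by (simp add: abs_mult mult.assoc)
  qed
qed

lemma unif_O_diff:
  "unif_O U n F \<Longrightarrow> unif_O U n G \<Longrightarrow> unif_O U n (\<lambda>h p. F h p - G h p)"
  using unif_O_add[of U n F "\<lambda>h p. -1 * G h p"] unif_O_cmult[of U n G "-1"] by simp

lemma unif_O_sum:
  "(\<And>i. i \<in> I \<Longrightarrow> unif_O U n (F i)) \<Longrightarrow> unif_O U n (\<lambda>h p. \<Sum>i\<in>I. F i h p)"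
  by (induction I rule: infinite_finite_induct) (auto intro: unif_O_0 unif_O_add)

lemma unif_O_power_mult:
  assumes "unif_O U n F"
  shows "unif_O U (m + n) (\<lambda>h p. h ^ m * F h p)"
proof (rule unif_OI)
  fix K assume K: "compact K" "K \<subseteq> U"
  obtain C where
    C: "\<And>h p. 0 < h \<Longrightarrow> h \<le> 1 \<Longrightarrow> p \<in> K \<Longrightarrow> \<bar>F h p\<bar> \<le> C * h ^ n"
    using unif_OE[OF assms K] by blast
  show "\<exists>C. \<forall>h p. 0 < h \<and> h \<le> 1 \<and> p \<in> K \<longrightarrow> \<bar>h ^ m * F h p\<bar> \<le> C * h ^ (m + n)"
  proof (intro exI allI impI)
    fix h :: real and p assume h: "0 < h \<and> h \<le> 1 \<and> p \<in> K"
    with C[of h p] have "h ^ m * \<bar>F h p\<bar> \<le> h ^ m * (C * h ^ n)"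
      by (intro mult_left_mono) auto
    with h show "\<bar>h ^ m * F h p\<bar> \<le> C * h ^ (m + n)"
      by (simp add: abs_mult power_add mult.left_commute)
  qed
qed

lemma unif_O_mono:
  assumes "unif_O U n F" "m \<le> n"
  shows "unif_O U m F"
proof (rule unif_OI)
  fix K assume K: "compact K" "K \<subseteq> U"
  obtain C where
    C: "\<And>h p. 0 < h \<Longrightarrow> h \<le> 1 \<Longrightarrow> p \<in> K \<Longrightarrow> \<bar>F h p\<bar> \<le> C * h ^ n"
    using unif_OE[OF assms(1) K] by blast
  show "\<exists>C. \<forall>h p. 0 < h \<and> h \<le> 1 \<and> p \<in> K \<longrightarrow> \<bar>F h p\<bar> \<le> C * h ^ m"
  proof (intro exI allI impI)
    fix h :: real and p assume h: "0 < h \<and> h \<le> 1 \<and> p \<in> K"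
    have "\<bar>F h p\<bar> \<le> C * h ^ n" using C h by blast
    \<comment> \<open>The constant may be negative when \<open>K\<close> is empty, so it is replaced
      by its absolute value before the powers are compared.\<close>
    also have "\<dots> \<le> \<bar>C\<bar> * h ^ n" using h by (intro mult_right_mono) auto
    also have "\<dots> \<le> \<bar>C\<bar> * h ^ m" using h assms(2) by (intro mult_left_mono power_decreasing) auto
    finally show "\<bar>F h p\<bar> \<le> \<bar>C\<bar> * h ^ m" .
  qed
qed

abbreviation half_space :: "(real \<times> 'a::topological_space) set" where
  "half_space \<equiv> {0<..} \<times> UNIV"

lemma open_half_space: "open half_space"
  by (intro open_Times) auto

text \<open>The shifted points, for \<open>p\<close> in \<open>K\<close> and \<open>h\<close> in
  [0, 1], form a compact set \<open>?L\<close>. It stays in the half space because time only moves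
  forward. The bound on \<open>?L\<close> is then used at the shifted point with the same
  \<open>h\<close>.\<close>

lemma unif_O_shift:
  fixes F :: "real \<Rightarrow> real \<times> 'a::real_normed_vector \<Rightarrow> real"
  assumes "unif_O half_space n F" "\<tau> \<ge> 0"
  shows "unif_O half_space n (\<lambda>(h::real) (t, x). F h (t + \<tau> * h\<^sup>2, x - h *\<^sub>R w))"
proof (rule unif_OI)
  fix K :: "(real \<times> 'a) set" assume K: "compact K" "K \<subseteq> half_space"
  let ?L = "(\<lambda>(p, h). (fst p + \<tau> * h\<^sup>2, snd p - h *\<^sub>R w)) ` (K \<times> {0..1})"
  have "compact ?L"
    using K(1) by (intro compact_continuous_image compact_Times)
      (auto intro!: continuous_intros simp: case_prod_unfold)
  moreover have "?L \<subseteq> half_space"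
  proof
    fix q assume "q \<in> ?L"
    then obtain p h where p: "p \<in> K" and q: "q = (fst p + \<tau> * h\<^sup>2, snd p - h *\<^sub>R w)" by auto
    from p K(2) have "0 < fst p" by auto
    with assms(2) have "0 < fst p + \<tau> * h\<^sup>2" by (simp add: add_pos_nonneg)
    with q show "q \<in> half_space" by simp
  qed
  ultimately obtain C where
    C: "\<And>h p. 0 < h \<Longrightarrow> h \<le> 1 \<Longrightarrow> p \<in> ?L \<Longrightarrow> \<bar>F h p\<bar> \<le> C * h ^ n"
    using unif_OE[OF assms(1)] by blast
  have "\<bar>case p of (t, x) \<Rightarrow> F h (t + \<tau> * h\<^sup>2, x - h *\<^sub>R w)\<bar> \<le> C * h ^ n"
    if "0 < h" "h \<le> 1" "p \<in> K" for h p
  proof -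
    have "(fst p + \<tau> * h\<^sup>2, snd p - h *\<^sub>R w) \<in> ?L"
      using that by (intro image_eqI[of _ _ "(p, h)"]) auto
    from C[OF that(1,2) this] show ?thesis by (simp add: case_prod_unfold)
  qed
  then show "\<exists>C. \<forall>h p. 0 < h \<and> h \<le> 1 \<and> p \<in> K \<longrightarrow>
      \<bar>case p of (t, x) \<Rightarrow> F h (t + \<tau> * h\<^sup>2, x - h *\<^sub>R w)\<bar> \<le> C * h ^ n"
    by blast
qed

text \<open>The polynomial \<open>P\<close> does not depend on \<open>h\<close>, so its action is a
  finite combination of shifts with fixed coefficients; the power k of z is a time shift by
  (k/\<mu>) h^2.\<close>

lemma unif_O_st_apply:
  fixes F :: "real \<Rightarrow> real \<times> (real ^ 'd::finite) \<Rightarrow> real"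
  assumes "unif_O half_space n F" "\<mu> > 0" "\<And>h. 0 < h \<Longrightarrow> dt h = h\<^sup>2 / \<mu>"
  shows "unif_O half_space n (\<lambda>h. st_apply h (dt h) P (F h))"
proof (rule unif_O_cong)
  show "unif_O half_space n (\<lambda>h p. \<Sum>k\<le>degree P. \<Sum>z\<in>Poly_Mapping.keys (coeff P k).
      Poly_Mapping.lookup (coeff P k) z *
        (case p of (t, x) \<Rightarrow> F h (t + real k / \<mu> * h\<^sup>2, x - h *\<^sub>R lattice_vec z)))"
    using assms by (intro unif_O_sum unif_O_cmult unif_O_shift) auto
qed (auto simp: st_apply_def fd_apply_def assms(3))

section \<open>Taylor expansions in space and in time with locally uniform remainders\<close>

lemma taylor_unif_O:
  fixes f :: "real \<times> 'a::real_normed_vector \<Rightarrow> real"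
  assumes "smooth_on f half_space" "n > 0"
  shows "unif_O half_space n (\<lambda>h p. f (p + h *\<^sub>R (0, v)) -
    (\<Sum>m<n. (dir_deriv (0, v) ^^ m) f p / fact m * h ^ m))"
proof (rule unif_OI)
  fix K :: "(real \<times> 'a) set" assume K: "compact K" "K \<subseteq> half_space"
  then have "p + h *\<^sub>R (0, v) \<in> half_space" if "p \<in> K" for p h
    using that by (cases p) auto
  from taylor_uniform[OF assms(1) K(1) assms(2) this, of 1] obtain C where
    "\<And>p h. p \<in> K \<Longrightarrow> 0 < h \<Longrightarrow> h \<le> 1 \<Longrightarrow>
      \<bar>f (p + h *\<^sub>R (0, v)) - (\<Sum>m<n. (dir_deriv (0, v) ^^ m) f p / fact m * h ^ m)\<bar> \<le> C * h ^ n"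
          by blast
  then show "\<exists>C. \<forall>h p. 0 < h \<and> h \<le> 1 \<and> p \<in> K \<longrightarrow> \<bar>f (p + h *\<^sub>R (0, v)) -
    (\<Sum>m<n. (dir_deriv (0, v) ^^ m) f p / fact m * h ^ m)\<bar> \<le> C * h ^ n"
    by blast
qed

lemma taylor_time_unif_O:
  fixes f :: "real \<times> 'a::real_normed_vector \<Rightarrow> real"
  assumes "smooth_on f half_space" "n > 0" "\<mu> > 0"
  shows "unif_O half_space (2 * n) (\<lambda>h p. f (p + (h\<^sup>2 / \<mu>) *\<^sub>R (1, 0)) -
    (\<Sum>m<n. (dir_deriv (1, 0) ^^ m) f p / fact m * (h\<^sup>2 / \<mu>) ^ m))"
proof (rule unif_OI)
  fix K :: "(real \<times> 'a) set" assume K: "compact K" "K \<subseteq> half_space"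
  then have "p + h *\<^sub>R (1, 0) \<in> half_space" if "p \<in> K" "0 \<le> h" for p h
    using that by (cases p) (auto intro: add_pos_nonneg)
  \<comment> \<open>The value 1/\<mu> bounds the time step h^2/\<mu> for h at most 1. A remainder of
    order \<open>n\<close> in the time step has order \<open>2 * n\<close> in
    \<open>h\<close>.\<close>
  from taylor_uniform[OF assms(1) K(1) assms(2) this, of "1 / \<mu>"] obtain C where
    C: "\<And>p h. p \<in> K \<Longrightarrow> 0 < h \<Longrightarrow> h \<le> 1 / \<mu> \<Longrightarrow> \<bar>f (p + h *\<^sub>R (1, 0)) -
      (\<Sum>m<n. (dir_deriv (1, 0) ^^ m) f p / fact m * h ^ m)\<bar> \<le> C * h ^ n" by blast
  show "\<exists>C. \<forall>h p. 0 < h \<and> h \<le> 1 \<and> p \<in> K \<longrightarrow> \<bar>f (p + (h\<^sup>2 / \<mu>) *\<^sub>R (1, 0)) -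
    (\<Sum>m<n. (dir_deriv (1, 0) ^^ m) f p / fact m * (h\<^sup>2 / \<mu>) ^ m)\<bar> \<le> C * h ^ (2 * n)"
  proof (intro exI allI impI)
    fix h :: real and p assume h: "0 < h \<and> h \<le> 1 \<and> p \<in> K"
    then have "0 < h\<^sup>2 / \<mu>" "h\<^sup>2 / \<mu> \<le> 1 / \<mu>"
      using assms(3) by (auto intro!: divide_right_mono power_le_one)
    with C[of p "h\<^sup>2 / \<mu>"] h have "\<bar>f (p + (h\<^sup>2 / \<mu>) *\<^sub>R (1, 0)) -
      (\<Sum>m<n. (dir_deriv (1, 0) ^^ m) f p / fact m * (h\<^sup>2 / \<mu>) ^ m)\<bar> \<le> C * (h\<^sup>2 / \<mu>) ^ n"
      by blast
    also have "C * (h\<^sup>2 / \<mu>) ^ n = C / \<mu> ^ n * h ^ (2 * n)"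
      by (simp add: power_divide power_mult)
    finally show "\<bar>f (p + (h\<^sup>2 / \<mu>) *\<^sub>R (1, 0)) -
      (\<Sum>m<n. (dir_deriv (1, 0) ^^ m) f p / fact m * (h\<^sup>2 / \<mu>) ^ m)\<bar> \<le> C / \<mu> ^ n * h ^ (2 * n)" .
  qed
qed

section \<open>Expansion of the transport operator\<close>

lemma time_partial_eq_dir_deriv:
  fixes f :: "real \<times> 'a::real_normed_vector \<Rightarrow> real"
  assumes "f differentiable (at (t, x))"
  shows "time_partial f (t, x) = dir_deriv (1, 0) f (t, x)"
proof -
  \<comment> \<open>The line is based at time 0 so that its parameter is the time itself;
    differentiability is used only at parameter \<open>t\<close>, that is at
    \<open>(t, x)\<close>.\<close>
  have "((\<lambda>h. f ((0, x) + h *\<^sub>R (1, 0))) has_real_derivative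
      dir_deriv (1, 0) f ((0, x) + t *\<^sub>R (1, 0))) (at t)"
    by (rule has_real_derivative_dir_deriv) (simp add: assms)
  then show ?thesis
    by (simp add: time_partial_def DERIV_imp_deriv)
qed

lemma space_partial_eq_dir_deriv:
  fixes f :: "real \<times> (real ^ 'd::finite) \<Rightarrow> real"
  assumes "f differentiable (at (t, x))"
  shows "space_partial k (\<lambda>y. f (t, y)) x = dir_deriv (0, axis k 1) f (t, x)"
proof -
  have "((\<lambda>h. f ((t, x) + h *\<^sub>R (0, axis k 1))) has_real_derivative
      dir_deriv (0, axis k 1) f ((t, x) + 0 *\<^sub>R (0, axis k 1))) (at 0)"
    by (rule has_real_derivative_dir_deriv) (simp add: assms)
  then show ?thesis
    by (simp add: space_partial_def DERIV_imp_deriv)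
qed

text \<open>A homogeneous first-order operator with constant coefficients is the derivative along
  its coefficient vector. This moves the target equations into the calculus of
  \<open>dir_deriv\<close> on space-time.\<close>

lemma mv_op_eq_dir_deriv:
  fixes f :: "real \<times> (real ^ 'd::finite) \<Rightarrow> real"
  assumes "f differentiable (at (t, x))"
  shows "mv_op c M i j (\<lambda>y. f (t, y)) x = dir_deriv (0, mv_coeff c M i j) f (t, x)"
proof -
  have "(0, mv_coeff c M i j) = (\<Sum>k\<in>UNIV. (mv_coeff c M i j $ k) *\<^sub>R ((0::real), axis k (1::real)))"
    by (simp add: prod_eq_iff fst_sum snd_sum vec_eq_iff axis_def if_distrib cong: if_cong)
  then show ?thesis
    unfolding mv_op_def space_partial_eq_dir_deriv[OF assms]
    by (simp only: dir_deriv_sum_dir[OF assms] real_scaleR_def)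
qed

definition mv_apply ::
  "('q \<Rightarrow> int ^ 'd::finite) \<Rightarrow> real ^ 'q::finite ^ 'q \<Rightarrow> ('q \<Rightarrow> real \<times> (real ^ 'd) \<Rightarrow> real)
     \<Rightarrow> 'q \<Rightarrow> real \<times> (real ^ 'd) \<Rightarrow> real" where
  "mv_apply c M f j p = (\<Sum>l\<in>UNIV. dir_deriv (0, mv_coeff c M j l) (f l) p)"

text \<open>This is the m-th power of G computed in the basis of the velocities, where G is diagonal
  with entries the derivatives along the \<open>c a\<close>. Orders 0, 1 and 2 are identified below
  with iterates of \<open>mv_apply\<close>.\<close>

definition mv_power ::
  "('q \<Rightarrow> int ^ 'd::finite) \<Rightarrow> real ^ 'q::finite ^ 'q \<Rightarrow> nat \<Rightarrow> ('q \<Rightarrow> real \<times> (real ^ 'd) \<Rightarrow> real)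
     \<Rightarrow> 'q \<Rightarrow> real \<times> (real ^ 'd) \<Rightarrow> real" where
  "mv_power c M m f j p = (\<Sum>l\<in>UNIV. \<Sum>a\<in>UNIV. M $ j $ a * matrix_inv M $ a $ l *
     (dir_deriv (0, lattice_vec (c a)) ^^ m) (f l) p)"

lemma mv_coeff_eq_sum:
  "mv_coeff c M j l = (\<Sum>a\<in>UNIV. (M $ j $ a * matrix_inv M $ a $ l) *\<^sub>R lattice_vec (c a))"
  by (simp add: mv_coeff_def matrix_matrix_mult_def diag_matrix_def lattice_vec_def vec_eq_iff
      if_distrib[of "(*) a" for a] mult.commute mult.left_commute cong: if_cong)

lemma smooth_on_mv_apply:
  assumes "\<And>l. smooth_on (f l) half_space"
  shows "smooth_on (mv_apply c M f j) half_space"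
  unfolding mv_apply_def[abs_def]
  by (intro smooth_on_sum open_half_space smooth_on_dir_deriv assms)

lemma
  assumes "invertible A"
  shows matrix_inv_right: "A ** matrix_inv A = mat 1" and matrix_inv_left: "matrix_inv A ** A
      = mat 1"
  using someI_ex[OF assms[unfolded invertible_def]] unfolding matrix_inv_def by auto

lemma mv_power_0:
  assumes "invertible M"
  shows "mv_power c M 0 f j p = f j p"
proof -
  have "mv_power c M 0 f j p = (\<Sum>l\<in>UNIV. (M ** matrix_inv M) $ j $ l * f l p)"
    by (simp add: mv_power_def matrix_matrix_mult_def sum_distrib_right)
  also have "\<dots> = f j p"
    by (simp add: matrix_inv_right[OF assms] mat_def
        if_distrib[of "\<lambda>x. x * a" for a] cong: if_cong)
  finally show ?thesis .
qed

lemma mv_power_1: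
  assumes "\<And>l. f l differentiable (at p)"
  shows "mv_power c M 1 f j p = mv_apply c M f j p"
proof -
  have "dir_deriv (0, mv_coeff c M j l) (f l) p = (\<Sum>a\<in>UNIV. M $ j $ a * matrix_inv M $ a $ l *
     dir_deriv (0, lattice_vec (c a)) (f l) p)" for l
  proof -
    have "(0, mv_coeff c M j l) = (\<Sum>a\<in>UNIV. (M $ j $ a * matrix_inv M $ a $ l) *\<^sub>R
        ((0::real), lattice_vec (c a)))"
      by (simp add: prod_eq_iff fst_sum snd_sum mv_coeff_eq_sum)
    then show ?thesis by (simp only: dir_deriv_sum_dir[OF assms] real_scaleR_def)
  qed
  then show ?thesis by (simp add: mv_power_def mv_apply_def)
qed

text \<open>Composing G with itself puts the product of \<open>matrix_inv M\<close> and
  \<open>M\<close> between two diagonal matrices of derivatives, and it cancels.\<close>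

lemma mv_power_2:
  assumes "invertible M" "\<And>l. smooth_on (f l) half_space" "p \<in> half_space"
  shows "mv_power c M 2 f j p = mv_apply c M (mv_apply c M f) j p"
proof -
  let ?D = "\<lambda>a. dir_deriv (0, lattice_vec (c a))"
  \<comment> \<open>The derivative along \<open>c b\<close> of component \<open>b\<close> of
    \<open>matrix_inv M\<close> applied to \<open>f\<close>.\<close>
  let ?F = "\<lambda>b p. \<Sum>l\<in>UNIV. matrix_inv M $ b $ l * ?D b (f l) p"
  have diff: "g differentiable (at q)" if "smooth_on g half_space" "q \<in> half_space"
      for g :: "_ \<Rightarrow> real" and q
    using smooth_on_imp_differentiable that by blast
  have smF: "smooth_on (?F b) half_space" for b
    by (intro smooth_on_sum open_half_space smooth_on_cmult smooth_on_dir_deriv assms)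
  have G: "mv_apply c M f k q = (\<Sum>b\<in>UNIV. M $ k $ b * ?F b q)" if "q \<in> half_space" for k q
  proof -
    have "mv_apply c M f k q = mv_power c M 1 f k q"
      using mv_power_1[of f q] diff assms(2) that by metis
    also have "\<dots> = (\<Sum>b\<in>UNIV. M $ k $ b * ?F b q)"
      unfolding mv_power_def by (subst sum.swap) (simp add: sum_distrib_left mult.assoc)
    finally show ?thesis .
  qed
  have "mv_apply c M (mv_apply c M f) j p = mv_power c M 1 (mv_apply c M f) j p"
    by (intro mv_power_1[symmetric] diff smooth_on_mv_apply assms)
  also have "\<dots> = (\<Sum>k\<in>UNIV. \<Sum>a\<in>UNIV. \<Sum>b\<in>UNIV.
      M $ j $ a * matrix_inv M $ a $ k * (M $ k $ b * ?D a (?F b) p))"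
  proof -
    \<comment> \<open>The formula \<open>G\<close> holds only on the half space; since this set is
      open, it may be differentiated there.\<close>
    have "?D a (mv_apply c M f k) p = (\<Sum>b\<in>UNIV. M $ k $ b * ?D a (?F b) p)" for a k
      by (rule trans[OF dir_deriv_cong[OF open_half_space G assms(3)] dir_deriv_sum])
        (auto intro: diff[OF smF] assms)
    then show ?thesis by (simp add: mv_power_def sum_distrib_left)
  qed
  also have "\<dots> = (\<Sum>a\<in>UNIV. \<Sum>k\<in>UNIV. \<Sum>b\<in>UNIV.
      M $ j $ a * matrix_inv M $ a $ k * (M $ k $ b * ?D a (?F b) p))"
    by (rule sum.swap)
  also have "\<dots> = (\<Sum>a\<in>UNIV. \<Sum>b\<in>UNIV. \<Sum>k\<in>UNIV.
      M $ j $ a * matrix_inv M $ a $ k * (M $ k $ b * ?D a (?F b) p))"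
    by (intro sum.cong refl sum.swap)
  \<comment> \<open>Summing over the intermediate moment \<open>k\<close> first leaves only the
    terms with \<open>a\<close> equal to \<open>b\<close>.\<close>
  also have "\<dots> = (\<Sum>a\<in>UNIV. \<Sum>b\<in>UNIV. (matrix_inv M ** M) $ a $ b * (M $ j $ a * ?D a (?F b) p))"
    by (simp add: matrix_matrix_mult_def sum_distrib_right sum_distrib_left mult_ac)
  also have "\<dots> = (\<Sum>a\<in>UNIV. M $ j $ a * ?D a (?F a) p)"
    by (simp add: matrix_inv_left[OF assms(1)] mat_def
        if_distrib[of "\<lambda>x. x * a" for a] cong: if_cong)
  also have "\<dots> = (\<Sum>a\<in>UNIV. \<Sum>l\<in>UNIV. M $ j $ a * matrix_inv M $ a $ l * ?D a (?D a (f l)) p)"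
  proof -
    have "?D a (?F a) p = (\<Sum>l\<in>UNIV. matrix_inv M $ a $ l * ?D a (?D a (f l)) p)" for a
      by (rule dir_deriv_sum) (auto intro: diff smooth_on_dir_deriv assms)
    then show ?thesis by (simp add: sum_distrib_left mult.assoc)
  qed
  also have "\<dots> = mv_power c M 2 f j p"
    unfolding mv_power_def by (subst sum.swap) (simp add: numeral_2_eq_2)
  finally show ?thesis ..
qed

text \<open>This is exp(-hG) truncated after \<open>n\<close> terms. In the velocity basis,
  transport consists of independent shifts by \<open>- h\<close> times a velocity, and each one is
  expanded by Taylor's formula.\<close>

lemma transport_expansion:
  fixes f :: "'q::finite \<Rightarrow> real \<times> (real ^ 'd::finite) \<Rightarrow> real"
  assumes "\<And>l. smooth_on (f l) half_space" "n > 0"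
  shows "unif_O half_space n (\<lambda>h (t, x).
    (\<Sum>l\<in>UNIV. fd_apply h (lbm_T c M $ j $ l) (\<lambda>y. f l (t, y)) x)
      - (\<Sum>m<n. (- h) ^ m / fact m * mv_power c M m f j (t, x)))"
proof (rule unif_O_cong)
  let ?v = "\<lambda>a. (0::real, lattice_vec (c a))"
  show "unif_O half_space n (\<lambda>h p. \<Sum>l\<in>UNIV. \<Sum>a\<in>UNIV. M $ j $ a * matrix_inv M $ a $ l *
     (f l (p + h *\<^sub>R (0, - lattice_vec (c a))) -
       (\<Sum>m<n. (dir_deriv (0, - lattice_vec (c a)) ^^ m) (f l) p / fact m * h ^ m)))"
    by (intro unif_O_sum unif_O_cmult taylor_unif_O assms)
  fix h :: real and p :: "real \<times> (real ^ 'd)" assume p: "p \<in> half_space"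
  obtain t x where tx: "p = (t, x)" by (cases p)
  have "(dir_deriv (0, - lattice_vec (c a)) ^^ m) (f l) p
      = (- 1) ^ m * (dir_deriv (?v a) ^^ m) (f l) p"
    for m :: nat and a l
    using dir_deriv_minus_power[OF open_half_space assms(1) p, where v = "?v a"] by simp
  then have "(\<Sum>l\<in>UNIV. \<Sum>a\<in>UNIV. M $ j $ a * matrix_inv M $ a $ l *
     (f l (p + h *\<^sub>R (0, - lattice_vec (c a))) -
       (\<Sum>m<n. (dir_deriv (0, - lattice_vec (c a)) ^^ m) (f l) p / fact m * h ^ m)))
    = (\<Sum>l\<in>UNIV. fd_apply h (lbm_T c M $ j $ l) (\<lambda>y. f l (t, y)) x)
      - (\<Sum>l\<in>UNIV. \<Sum>a\<in>UNIV. \<Sum>m<n. (- h) ^ m / fact m *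
          (M $ j $ a * matrix_inv M $ a $ l * (dir_deriv (?v a) ^^ m) (f l) p))"
    unfolding tx by (simp add: fd_apply_lbm_T right_diff_distrib sum_subtractf sum_distrib_left
        power_minus[of h] mult_ac)
  also have "(\<Sum>l\<in>UNIV. \<Sum>a\<in>UNIV. \<Sum>m<n. (- h) ^ m / fact m *
          (M $ j $ a * matrix_inv M $ a $ l * (dir_deriv (?v a) ^^ m) (f l) p))
      = (\<Sum>m<n. (- h) ^ m / fact m * mv_power c M m f j p)"
    unfolding mv_power_def sum_distrib_left
    by (subst sum.swap[of _ UNIV "{..<n}"], subst sum.swap[of _ UNIV "{..<n}"]) (rule refl)
  finally show "(\<Sum>l\<in>UNIV. \<Sum>a\<in>UNIV. M $ j $ a * matrix_inv M $ a $ l *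
     (f l (p + h *\<^sub>R (0, - lattice_vec (c a))) -
       (\<Sum>m<n. (dir_deriv (0, - lattice_vec (c a)) ^^ m) (f l) p / fact m * h ^ m)))
    = (case p of (t, x) \<Rightarrow> (\<Sum>l\<in>UNIV. fd_apply h (lbm_T c M $ j $ l) (\<lambda>y. f l (t, y)) x)
      - (\<Sum>m<n. (- h) ^ m / fact m * mv_power c M m f j (t, x)))"
    unfolding tx by simp
qed

text \<open>The \<open>a0\<close>, \<open>a1\<close>, \<open>a2\<close> expand the moments before
  collision and \<open>f0\<close>, \<open>f1\<close>, \<open>f2\<close> those after it. The
  conditions \<open>order0\<close>, \<open>order1\<close>, \<open>order2\<close> equate the
  coefficients of 1, h and h^2 in z m = T f, where z = 1 + (h^2/\<mu>) d/dt + ... and T = 1 - hG +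
  h^2 G^2/2 - ... .\<close>

lemma lbm_defect_unif_O:
  fixes c :: "'q::finite \<Rightarrow> int ^ 'd::finite"
    and a0 a1 a2 f0 f1 f2 :: "'q \<Rightarrow> real \<times> (real ^ 'd) \<Rightarrow> real"
  assumes inv: "invertible M" and mu: "\<mu> > 0" and dt: "\<And>h. 0 < h \<Longrightarrow> dt h = h\<^sup>2 / \<mu>"
    and smooth: "\<And>l. smooth_on (a0 l) half_space" "\<And>l. smooth_on (a1 l) half_space"
      "\<And>l. smooth_on (a2 l) half_space" "\<And>l. smooth_on (f0 l) half_space"
      "\<And>l. smooth_on (f1 l) half_space" "\<And>l. smooth_on (f2 l) half_space"
    and m: "\<And>h l p. m h l p = a0 l p + h * a1 l p + h\<^sup>2 * a2 l p"
    and f: "\<And>h l p. 0 < h \<Longrightarrow> p \<in> half_space \<Longrightarrow>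
      (1 - s $ l) * m h l p + s $ l * e h l p = f0 l p + h * f1 l p + h\<^sup>2 * f2 l p"
    and order0: "\<And>p. p \<in> half_space \<Longrightarrow> f0 j p = a0 j p"
    and order1: "\<And>p. p \<in> half_space \<Longrightarrow> f1 j p = a1 j p + mv_apply c M f0 j p"
    and order2: "\<And>p. p \<in> half_space \<Longrightarrow> f2 j p = a2 j p + (dir_deriv (1, 0) (a0 j) p / \<mu>
      + mv_apply c M f1 j p - mv_apply c M (mv_apply c M f0) j p / 2)"
  shows "unif_O half_space 3 (\<lambda>h. lbm_defect c M s h (dt h) (m h) (e h) j)"
proof -
  let ?T = "\<lambda>f h (t, x). \<Sum>l\<in>UNIV. fd_apply h (lbm_T c M $ j $ l) (\<lambda>y. f l (t, y)) x"
  let ?q = "\<lambda>h p. p + (h\<^sup>2 / \<mu>) *\<^sub>R (1, 0::real ^ 'd)"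
  have diff: "g differentiable (at p)" if "smooth_on g half_space" "p \<in> half_space"
    for g :: "real \<times> (real ^ 'd) \<Rightarrow> real" and p
    using smooth_on_imp_differentiable that by blast
  \<comment> \<open>A time step counts as two orders in \<open>h\<close>. Hence only
    \<open>a0\<close> needs its first time derivative, while \<open>a1\<close> and \<open>a2\<close>
    may be frozen in time; orders 4 are weakened to 3.\<close>
  have time0: "unif_O half_space 3 (\<lambda>h p. a0 j (?q h p) - (a0 j p
      + dir_deriv (1, 0) (a0 j) p * (h\<^sup>2 / \<mu>)))"
    using unif_O_mono[OF taylor_time_unif_O[OF smooth(1)[of j] _ mu, of 2], of 3]
    by (simp add: numeral_2_eq_2)
  have time1: "unif_O half_space 3 (\<lambda>h p. h ^ 1 * (a1 j (?q h p) - a1 j p))"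
    using unif_O_power_mult[OF taylor_time_unif_O[OF smooth(2)[of j] _ mu, of 1], of 1]
    by (simp add: numeral_3_eq_3)
  have time2: "unif_O half_space 3 (\<lambda>h p. h ^ 2 * (a2 j (?q h p) - a2 j p))"
    using unif_O_mono[OF unif_O_power_mult[OF taylor_time_unif_O[OF smooth(3)[of j] _ mu, of 1],
        of 2], of 3]
    by simp
  \<comment> \<open>The prefactors 1, h and h^2 allow 3, 2 and 1 terms of the transport series for
    \<open>f0\<close>, \<open>f1\<close> and \<open>f2\<close>.\<close>
  have "unif_O half_space 3 (\<lambda>h (t, x). ?T f0 h (t, x)
      - (\<Sum>m<3. (- h) ^ m / fact m * mv_power c M m f0 j (t, x)))"
    using transport_expansion[where f = f0, OF smooth(4), of 3] by simp
  then have space0: "unif_O half_space 3 (\<lambda>h p. ?T f0 h p -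
      (f0 j p - h * mv_apply c M f0 j p + h\<^sup>2 / 2 * mv_apply c M (mv_apply c M f0) j p))"
    by (rule unif_O_cong)
      (use smooth(4) in \<open>auto simp: numeral_3_eq_3 mv_power_0[OF inv] mv_power_1[unfolded
          One_nat_def]
        diff mv_power_2[OF inv, unfolded numeral_2_eq_2] power2_eq_square\<close>)
  have "unif_O half_space 3 (\<lambda>h p. h ^ 1 * (case p of (t, x) \<Rightarrow>
      ?T f1 h (t, x) - (\<Sum>m<2. (- h) ^ m / fact m * mv_power c M m f1 j (t, x))))"
    using unif_O_power_mult[OF transport_expansion[where f = f1, OF smooth(5), of 2], of 1]
    by (simp add: case_prod_unfold numeral_3_eq_3)
  then have space1: "unif_O half_space 3 (\<lambda>h p. h * (?T f1 h p - (f1 j p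
      - h * mv_apply c M f1 j p)))"
    by (rule unif_O_cong)
      (use smooth(5) in \<open>auto simp: numeral_2_eq_2 mv_power_0[OF inv] mv_power_1[unfolded
          One_nat_def] diff\<close>)
  have "unif_O half_space 3 (\<lambda>h p. h ^ 2 * (case p of (t, x) \<Rightarrow>
      ?T f2 h (t, x) - (\<Sum>m<1. (- h) ^ m / fact m * mv_power c M m f2 j (t, x))))"
    using unif_O_power_mult[OF transport_expansion[where f = f2, OF smooth(6), of 1], of 2]
    by (simp add: case_prod_unfold numeral_3_eq_3)
  then have space2: "unif_O half_space 3 (\<lambda>h p. h\<^sup>2 * (?T f2 h p - f2 j p))"
    by (rule unif_O_cong) (auto simp: mv_power_0[OF inv])
  show ?thesis
  \<comment> \<open>The defect equals this combination of the six remainders exactly, because the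
    order conditions cancel all retained Taylor terms.\<close>
  proof (rule unif_O_cong[OF unif_O_diff[OF unif_O_diff[OF unif_O_diff[OF
          unif_O_add[OF unif_O_add[OF time0 time1] time2] space0] space1] space2]])
    fix h :: real and p :: "real \<times> (real ^ 'd)"
    assume h: "0 < h" and p: "p \<in> half_space"
    obtain t x where tx: "p = (t, x)" by (cases p)
    have "(\<lambda>y. (1 - s $ l) * m h l (t, y) + s $ l * e h l (t, y))
        = (\<lambda>y. f0 l (t, y) + h * f1 l (t, y) + h\<^sup>2 * f2 l (t, y))" for l
      using f[OF h] p tx by auto
    note collision = this
    have "lbm_defect c M s h (dt h) (m h) (e h) j p
        = m h j (?q h p) - (?T f0 h p + h * ?T f1 h p + h\<^sup>2 * ?T f2 h p)"
      unfolding tx lbm_defect_def prod.case collision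
      by (simp add: dt[OF h] fd_apply_add_fun fd_apply_cmult_fun sum.distrib
          sum_distrib_left)
    then show "a0 j (?q h p) - (a0 j p + dir_deriv (1, 0) (a0 j) p * (h\<^sup>2 / \<mu>))
        + h ^ 1 * (a1 j (?q h p) - a1 j p) + h ^ 2 * (a2 j (?q h p) - a2 j p)
        - (?T f0 h p - (f0 j p - h * mv_apply c M f0 j p
            + h\<^sup>2 / 2 * mv_apply c M (mv_apply c M f0) j p))
        - h * (?T f1 h p - (f1 j p - h * mv_apply c M f1 j p))
        - h\<^sup>2 * (?T f2 h p - f2 j p)
      = lbm_defect c M s h (dt h) (m h) (e h) j p"
      unfolding m order0[OF p] order1[OF p] order2[OF p]
      by (simp add: algebra_simps power2_eq_square)
  qed
qed

section \<open>Chapman-Enskog ansatz and truncation error\<close>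

theorem theorem4p10:
  fixes c :: "('n::finite + 'k::finite) \<Rightarrow> int ^ 'd::finite"
    and M :: "real ^ ('n + 'k) ^ ('n + 'k)"
    and s :: "real ^ ('n + 'k)"
    and meq :: "real \<Rightarrow> real ^ 'n \<Rightarrow> real ^ ('n + 'k)"
    and mhat mfix :: "'n + 'k \<Rightarrow> real ^ 'n \<Rightarrow> real"
    and dt :: "real \<Rightarrow> real"
    and \<mu> :: real
  assumes dim: "CARD('d) \<in> {1, 2, 3}"
    and M_inv: "invertible M"
    and relax: "\<And>j. 0 < s $ Inr j \<and> s $ Inr j \<le> 2"
    and eq_smooth: "\<And>dx. 0 < dx \<Longrightarrow> smooth_on (meq dx) UNIV"
    and eq_conserved: "\<And>dx v i. 0 < dx \<Longrightarrow> meq dx v $ Inl i = v $ i"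
    and mu_pos: "0 < \<mu>"
    and dt_pos: "\<And>dx. 0 < dx \<Longrightarrow> 0 < dt dx"
    and diffusive: "\<And>dx. 0 < dx \<Longrightarrow> dx / dt dx = \<mu> / dx"
    and G_zero: "\<And>i j. mv_coeff c M (Inl i) (Inl j) = 0"
    and eq_Omega: "\<And>dx j v. 0 < dx \<Longrightarrow> j \<in> Omega c M \<Longrightarrow> meq dx v $ j = dx * mhat j v"
    and eq_not_Omega: "\<And>dx j v. 0 < dx \<Longrightarrow> j \<notin> Omega c M \<Longrightarrow> meq dx v $ j = mfix j v"
  shows "consistent_with c M s meq dt {u. smooth_target_solution c M s \<mu> mhat mfix u} \<and>
    (\<forall>u. smooth_target_solution c M s \<mu> mhat mfix u \<longrightarrow>
       (\<forall>i. \<forall>t>0. \<forall>x.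
          (\<lambda>dx. truncation_error c M s (meq dx) dx (dt dx) i u (t, x)) \<in> O[at_right 0](\<lambda>dx. dx)))"
proof -
  have dt: "dt h = h\<^sup>2 / \<mu>" if "0 < h" for h
    using diffusive[OF that] dt_pos[OF that] mu_pos that by (simp add: field_simps power2_eq_square)
  have Inl_Omega: "Inl i \<notin> Omega c M" for i
    by (simp add: Omega_def G_zero)
  \<comment> \<open>At space step 1 the scaled equilibria are themselves components of a smooth map;
    this covers both the part on \<open>Omega\<close> and the part off it.\<close>
  have smooth_hat: "smooth_on (mhat l) UNIV" if "l \<in> Omega c M" for l
    using smooth_on_vec_nth[OF open_UNIV eq_smooth[of 1], of l] eq_Omega[OF _ that, of 1] by simp
  have smooth_fix: "smooth_on (mfix l) UNIV" if "l \<notin> Omega c M" for l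
    using smooth_on_vec_nth[OF open_UNIV eq_smooth[of 1], of l] eq_not_Omega[OF _ that, of 1]
        by simp
  have mfix_Inl: "mfix (Inl i) v = v $ i" for i v
    using eq_conserved[of 1 v i] eq_not_Omega[OF _ Inl_Omega, of 1 v i] by simp
  have bound: "\<exists>C. \<forall>h. 0 < h \<and> h \<le> 1 \<longrightarrow>
      \<bar>truncation_error c M s (meq h) h (dt h) i u (t, x)\<bar> \<le> C * h"
    if sol: "smooth_target_solution c M s \<mu> mhat mfix u" and t: "t > 0" for u i t x
  proof -
    from sol have smooth_u: "smooth_on u half_space"
      and target: "\<And>i t x. t > 0 \<Longrightarrow> target_lhs c M s \<mu> mhat mfix i u (t, x) = 0"
      by (auto simp: smooth_target_solution_def)
    have diff: "g differentiable (at p)" if "smooth_on g half_space" "p \<in> half_space"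
      for g :: "real \<times> (real ^ 'd) \<Rightarrow> real" and p
      using smooth_on_imp_differentiable that by blast
    \<comment> \<open>The equilibrium of \<open>u\<close> is exactly \<open>f0 l + h * mh l\<close>:
      components off \<open>Omega\<close> have order 0 and those on \<open>Omega\<close> have order
      1. On conserved indices \<open>f0\<close> is \<open>u\<close> and \<open>mh\<close> is
      zero.\<close>
    define f0 where "f0 l = (if l \<in> Omega c M then (\<lambda>p. 0) else (\<lambda>p. mfix l (u p)))" for l
    define mh where "mh l = (if l \<in> Omega c M then (\<lambda>p. mhat l (u p)) else (\<lambda>p. 0))" for l
    define \<sigma> where "\<sigma> l = (case l of Inl _ \<Rightarrow> 0 | Inr _ \<Rightarrow> 1 / s $ l)" for l
    \<comment> \<open>Since \<open>\<sigma>\<close> vanishes on conserved indices, the conserved components of the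
      moments \<open>m h\<close> below are exactly \<open>u\<close>, on the whole of space-time.\<close>
    define g where "g = mv_apply c M f0"
    \<comment> \<open>With zeroth order \<open>f0\<close>, the collision rule at order h reads (1 -
      s) a1 + s mh = a1 + g, and at order h^2 it reads (1 - s) a2 = a2 + W. Solving for
      non-conserved indices gives a1 = mh - g/s and a2 = -W/s.\<close>
    define a1 where "a1 l p = mh l p - \<sigma> l * g l p" for l p
    define f1 where "f1 l p = a1 l p + g l p" for l p
    define W where "W l p = dir_deriv (1, 0) (f0 l) p / \<mu> + mv_apply c M f1 l p
        - mv_apply c M g l p / 2" for l p
    define a2 where "a2 l p = - \<sigma> l * W l p" for l p
    define f2 where "f2 l p = a2 l p + W l p" for l p
    define m where "m h l p = f0 l p + h * a1 l p + h\<^sup>2 * a2 l p" for h l p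
    have sm_f0: "smooth_on (f0 l) half_space" and sm_mh: "smooth_on (mh l) half_space" for l
      by (auto simp: f0_def mh_def intro!: smooth_on_const smooth_on_compose open_half_space
          smooth_hat smooth_fix smooth_u)
    have sm_g: "smooth_on (g l) half_space" for l
      unfolding g_def by (intro smooth_on_mv_apply sm_f0)
    have sm_a1: "smooth_on (a1 l) half_space" for l
      unfolding a1_def[abs_def] by (intro smooth_on_diff smooth_on_cmult open_half_space sm_mh sm_g)
    have sm_f1: "smooth_on (f1 l) half_space" for l
      unfolding f1_def[abs_def] by (intro smooth_on_add open_half_space sm_a1 sm_g)
    have sm_W: "smooth_on (W l) half_space" for l
      using smooth_on_diff[OF open_half_space smooth_on_add[OF open_half_space
            smooth_on_cmult[OF open_half_space smooth_on_dir_deriv[OF sm_f0[of l], of "(1, 0)"],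
                of "1 / \<mu>"]
            smooth_on_mv_apply[where f = f1 and c = c and M = M and j = l, OF sm_f1]]
          smooth_on_cmult[OF open_half_space smooth_on_mv_apply[where f = g and c = c and M
              = M and j = l, OF sm_g], of "1 / 2"]]
      unfolding W_def[abs_def] by simp
    have sm_a2: "smooth_on (a2 l) half_space" for l
      unfolding a2_def[abs_def] by (intro smooth_on_cmult open_half_space sm_W)
    have sm_f2: "smooth_on (f2 l) half_space" for l
      unfolding f2_def[abs_def] by (intro smooth_on_add open_half_space sm_a2 sm_W)
    \<comment> \<open>A conserved row of G has nonzero entries only in columns of
      \<open>Omega\<close>, where \<open>f0\<close> vanishes. So the first-order flux of the
      conserved moments is zero, as the diffusive scaling requires.\<close>
    have g_Inl: "g (Inl i) p = 0" if "p \<in> half_space" for i p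
    proof -
      have "dir_deriv (0, mv_coeff c M (Inl i) l) (f0 l) p = 0" for l
      proof (cases "l \<in> Omega c M")
        case True
        then show ?thesis by (simp add: f0_def)
      next
        case False
        then have "mv_coeff c M (Inl i) l = 0" by (auto simp: Omega_def)
        then show ?thesis
          using dir_deriv_0_dir[OF diff[OF sm_f0[of l] that]] by (simp add: zero_prod_def)
      qed
      then show ?thesis by (simp add: g_def mv_apply_def)
    qed
    \<comment> \<open>On conserved indices, \<mu> times \<open>W\<close> is the left-hand side of
      the target equation. This is where \<open>u\<close> being a solution is used.\<close>
    have W_Inl: "W (Inl i) p = 0" if p: "p \<in> half_space" for i p
    proof -
      obtain t x where tx: "p = (t, x)" by (cases p)
      with p have t: "t > 0" by simp
      let ?d = "\<lambda>j. dir_deriv (0, mv_coeff c M (Inl i) (Inr j))"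
      have zero: "dir_deriv (0, mv_coeff c M (Inl i) (Inl k)) h p = 0"
        if "smooth_on h half_space" for h :: "real \<times> (real ^ 'd) \<Rightarrow> real" and k
        using dir_deriv_0_dir[OF diff[OF that p]] by (simp add: G_zero zero_prod_def)
      \<comment> \<open>The factor 1 - 1/s, combined with the -1/2 from the second-order transport
        term in \<open>W\<close>, gives the diffusion coefficient -(1/s - 1/2).\<close>
      have df1: "?d j (f1 (Inr j)) p = ?d j (mh (Inr j)) p + (1
          - 1 / s $ Inr j) * ?d j (g (Inr j)) p" for j
      proof -
        have "f1 (Inr j) = (\<lambda>p. mh (Inr j) p + (1 - 1 / s $ Inr j) * g (Inr j) p)"
          by (simp add: fun_eq_iff f1_def a1_def \<sigma>_def algebra_simps)
        then have "?d j (f1 (Inr j)) p = ?d j (mh (Inr j)) p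
            + ?d j (\<lambda>p. (1 - 1 / s $ Inr j) * g (Inr j) p) p"
          by (simp only:) (intro dir_deriv_add diff smooth_on_cmult open_half_space sm_mh sm_g p)
        then show ?thesis by (simp only: dir_deriv_cmult[OF diff[OF sm_g p]])
      qed
      have "W (Inl i) p = dir_deriv (1, 0) (f0 (Inl i)) p / \<mu> + (\<Sum>j\<in>UNIV. ?d j (mh (Inr j)) p)
          - (\<Sum>j\<in>UNIV. (1 / s $ Inr j - 1 / 2) * ?d j (g (Inr j)) p)"
        by (simp add: W_def mv_apply_def sum_UNIV_sum_type zero sm_f1 sm_g df1
            sum.distrib[symmetric]
            sum_subtractf[symmetric] sum_divide_distrib algebra_simps)
      also have "dir_deriv (1, 0) (f0 (Inl i)) p = time_partial (\<lambda>p. u p $ i) (t, x)"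
        using time_partial_eq_dir_deriv[OF diff[OF sm_f0 p[unfolded tx]], of "Inl i"]
        by (simp add: f0_def Inl_Omega mfix_Inl tx)
      also have "(\<Sum>j\<in>UNIV. ?d j (mh (Inr j)) p) = (\<Sum>j | Inr j \<in> Omega c M.
          mv_op c M (Inl i) (Inr j) (\<lambda>y. mhat (Inr j) (u (t, y))) x)"
      proof -
        have "?d j (mh (Inr j)) p = mv_op c M (Inl i) (Inr j) (\<lambda>y. mhat (Inr j) (u (t, y))) x"
          if "Inr j \<in> Omega c M" for j
          using mv_op_eq_dir_deriv[OF diff[OF sm_mh p[unfolded tx]], of c M "Inl i" "Inr j" "Inr
              j"] that
          by (simp add: mh_def tx)
        then have "(\<Sum>j | Inr j \<in> Omega c M. ?d j (mh (Inr j)) p) = (\<Sum>j | Inr j \<in> Omega c M.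
            mv_op c M (Inl i) (Inr j) (\<lambda>y. mhat (Inr j) (u (t, y))) x)"
          by (intro sum.cong) auto
        moreover have "(\<Sum>j | Inr j \<in> Omega c M. ?d j (mh (Inr j)) p)
            = (\<Sum>j\<in>UNIV. ?d j (mh (Inr j)) p)"
          by (rule sum.mono_neutral_left) (auto simp: mh_def)
        ultimately show ?thesis by simp
      qed
      also have "(\<Sum>j\<in>UNIV. (1 / s $ Inr j - 1 / 2) * ?d j (g (Inr j)) p)
        = (\<Sum>j\<in>UNIV. (1 / s $ Inr j - 1 / 2) * mv_op c M (Inl i) (Inr j)
           (\<lambda>y. (\<Sum>l\<in>UNIV. mv_op c M (Inr j) (Inl l) (\<lambda>w. u (t, w) $ l) y)
              + (\<Sum>l | Inr l \<notin> Omega c M.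
                   mv_op c M (Inr j) (Inr l) (\<lambda>w. mfix (Inr l) (u (t, w))) y)) x)"
      proof -
        \<comment> \<open>The identity is needed at every \<open>y\<close>, since the outer operator
          differentiates it in space. Columns in \<open>Omega\<close> drop out because
          \<open>f0\<close> is zero there.\<close>
        have "g (Inr j) (t, y) = (\<Sum>l\<in>UNIV. mv_op c M (Inr j) (Inl l) (\<lambda>w. u (t, w) $ l) y)
              + (\<Sum>l | Inr l \<notin> Omega c M.
                   mv_op c M (Inr j) (Inr l) (\<lambda>w. mfix (Inr l) (u (t, w))) y)" for j y
        proof -
          have "(t, y) \<in> half_space" using t by simp
          note op = mv_op_eq_dir_deriv[OF diff[OF sm_f0 this], of c M, symmetric]
          have "g (Inr j) (t, y) = (\<Sum>l\<in>UNIV. mv_op c M (Inr j) (Inl l) (\<lambda>w. f0 (Inl l) (t, w)) y)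
              + (\<Sum>l\<in>UNIV. mv_op c M (Inr j) (Inr l) (\<lambda>w. f0 (Inr l) (t, w)) y)"
            by (simp add: g_def mv_apply_def sum_UNIV_sum_type op)
          also have "(\<Sum>l\<in>UNIV. mv_op c M (Inr j) (Inr l) (\<lambda>w. f0 (Inr l) (t, w)) y)
              = (\<Sum>l | Inr l \<notin> Omega c M. mv_op c M (Inr j) (Inr l) (\<lambda>w. f0 (Inr l) (t, w)) y)"
          proof (rule sum.mono_neutral_right)
            show "\<forall>l\<in>UNIV - {l. Inr l \<notin> Omega c M}. mv_op c M (Inr j) (Inr l) (\<lambda>w. f0 (Inr l) (t,
                w)) y = 0"
              by (auto simp: op[symmetric] f0_def mv_op_def space_partial_def)
          qed auto
          also have "\<dots> = (\<Sum>l | Inr l \<notin> Omega c M. mv_op c M (Inr j) (Inr l) (\<lambda>w. mfix (Inr l) (u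
              (t, w))) y)"
            by (intro sum.cong) (auto simp: f0_def)
          finally show ?thesis by (simp add: f0_def Inl_Omega mfix_Inl)
        qed
        then show ?thesis
          using mv_op_eq_dir_deriv[OF diff[OF sm_g p[unfolded tx]], of c M "Inl i", symmetric]
          by (simp add: tx)
      qed
      finally show ?thesis
        using target[OF t, of i x] mu_pos by (simp add: target_lhs_def field_simps)
    qed
    have collision: "(1 - s $ l) * m h l p + s $ l * meq h (u p) $ l = f0 l p + h * f1 l p
        + h\<^sup>2 * f2 l p"
      if h: "0 < h" and p: "p \<in> half_space" for h l p
    proof -
      have "meq h (u p) $ l = f0 l p + h * mh l p"
        using eq_Omega[OF h] eq_not_Omega[OF h] by (simp add: f0_def mh_def)
      \<comment> \<open>For non-conserved indices \<open>s $ l * \<sigma> l\<close> is 1. For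
        conserved ones, where \<open>s $ l\<close> is arbitrary, both sides vanish by
        \<open>g_Inl\<close> and \<open>W_Inl\<close>.\<close>
      moreover have relaxed: "s $ l * \<sigma> l * g l p = g l p" "s $ l * \<sigma> l * W l p = W l p"
        using g_Inl[OF p] W_Inl[OF p] relax by (auto simp: \<sigma>_def less_le split: sum.split)
      moreover have "(1 - s $ l) * m h l p + s $ l * (f0 l p + h * mh l p)
          - (f0 l p + h * f1 l p + h\<^sup>2 * f2 l p)
        = h * (s $ l * \<sigma> l * g l p - g l p) + h\<^sup>2 * (s $ l * \<sigma> l * W l p - W l p)"
        by (simp add: m_def f1_def f2_def a1_def a2_def algebra_simps)
      then have "(1 - s $ l) * m h l p + s $ l * (f0 l p + h * mh l p) = f0 l p + h * f1 l p
          + h\<^sup>2 * f2 l p"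
        unfolding relaxed by simp
      ultimately show ?thesis by simp
    qed
    \<comment> \<open>The order conditions hold in every row by the definitions of
      \<open>f1\<close>, \<open>f2\<close> and \<open>W\<close>; the target equation has entered
      through \<open>collision\<close>.\<close>
    have "unif_O half_space 3 (\<lambda>h. lbm_defect c M s h (dt h) (m h) (\<lambda>l p. meq h (u p) $ l) j)" for j
      by (rule lbm_defect_unif_O[OF M_inv mu_pos dt sm_f0 sm_a1 sm_a2 sm_f0 sm_f1 sm_f2 m_def
          collision])
        (simp_all only: f1_def[of j] f2_def[of j] W_def[of j] g_def[symmetric])
    then have "unif_O half_space 3 (\<lambda>h p. \<Sum>j\<in>UNIV.
        st_apply h (dt h) (adjugate (fd_char_matrix c M s i) $ Inl i $ j)
          (lbm_defect c M s h (dt h) (m h) (\<lambda>l p. meq h (u p) $ l) j) p)"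
      by (intro unif_O_sum unif_O_st_apply[OF _ mu_pos dt])
    then have residual: "unif_O half_space 3 (\<lambda>h p. fd_residual c M s (meq h) h (dt h) i u p)"
    proof (rule unif_O_cong)
      fix h :: real and p :: "real \<times> (real ^ 'd)"
      show "(\<Sum>j\<in>UNIV. st_apply h (dt h) (adjugate (fd_char_matrix c M s i) $ Inl i $ j)
          (lbm_defect c M s h (dt h) (m h) (\<lambda>l p. meq h (u p) $ l) j) p)
        = fd_residual c M s (meq h) h (dt h) i u p"
        by (rule fd_residual_eq_defect[symmetric])
          (simp add: m_def f0_def a1_def a2_def mh_def \<sigma>_def Inl_Omega mfix_Inl)
    qed
    have "{(t, x)} \<subseteq> half_space" using t by simp
    then obtain C where "\<And>h p. 0 < h \<Longrightarrow> h \<le> 1 \<Longrightarrow> p \<in> {(t, x)} \<Longrightarrow>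
        \<bar>fd_residual c M s (meq h) h (dt h) i u p\<bar> \<le> C * h ^ 3"
      using unif_OE[OF residual compact_sing] by blast
    then have C: "\<bar>fd_residual c M s (meq h) h (dt h) i u (t, x)\<bar> \<le> C * h ^ 3"
      if "0 < h" "h \<le> 1" for h
      using that by blast
    define P where "P = (\<Prod>j\<in>UNIV. s $ Inr j)"
    have P: "P > 0"
      unfolding P_def using relax by (intro prod_pos) auto
    \<comment> \<open>Dividing a residual of order 3 by \<open>P * (h\<^sup>2 / \<mu>)\<close>
      leaves one power of \<open>h\<close>.\<close>
    have "\<bar>truncation_error c M s (meq h) h (dt h) i u (t, x)\<bar> \<le> C * \<mu> / P * h"
      if h: "0 < h" "h \<le> 1" for h
    proof -
      have "\<bar>truncation_error c M s (meq h) h (dt h) i u (t, x)\<bar>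
          = \<bar>fd_residual c M s (meq h) h (dt h) i u (t, x)\<bar> / (P * (h\<^sup>2 / \<mu>))"
        using P mu_pos h by (simp add: truncation_error_def P_def[symmetric] dt abs_mult)
      also have "\<dots> \<le> C * h ^ 3 / (P * (h\<^sup>2 / \<mu>))"
        using P mu_pos h by (intro divide_right_mono C) auto
      also have "\<dots> = C * \<mu> / P * h"
        using P mu_pos h by (simp add: field_simps power2_eq_square power3_eq_cube)
      finally show ?thesis .
    qed
    then show ?thesis by blast
  qed
  have "(\<lambda>dx. truncation_error c M s (meq dx) dx (dt dx) i u (t, x)) \<in> O[at_right 0](\<lambda>dx. dx)
      \<and> ((\<lambda>dx. truncation_error c M s (meq dx) dx (dt dx) i u (t, x)) \<longlongrightarrow> 0) (at_right 0)"
    if sol: "smooth_target_solution c M s \<mu> mhat mfix u" and t: "t > 0" for u i t x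
  proof -
    obtain C where C: "\<And>h. 0 < h \<Longrightarrow> h \<le> 1 \<Longrightarrow>
        \<bar>truncation_error c M s (meq h) h (dt h) i u (t, x)\<bar> \<le> C * h"
      using bound[OF sol t] by blast
    \<comment> \<open>Near 0 from the right the bound for steps up to 1 applies, and the majorant
      \<open>C * norm h\<close> yields both the order and the limit.\<close>
    have "eventually (\<lambda>h. h \<in> {0<..<1}) (at_right (0::real))"
      by (rule eventually_at_right_real) simp
    then have le: "eventually (\<lambda>h. norm (truncation_error c M s (meq h) h (dt h) i u (t, x))
        \<le> C * norm h) (at_right 0)"
      by eventually_elim (use C in auto)
    have "((\<lambda>h::real. C * norm h) \<longlongrightarrow> 0) (at_right 0)"
      by (auto intro!: tendsto_eq_intros)
    from bigoI[OF le] Lim_null_comparison[OF le this] show ?thesis ..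
  qed
  then show ?thesis
    unfolding consistent_with_def by blast
qed

end
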